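(* Let $\Bbbk$ be a commutative ring, let $A$ and $B$ be $\Bbbk$-algebras, and let $(M,N,\eta,\rho)$ be a Morita context between $A$ and $B$. Let $I\subset A$ and $J\subset B$ be the images of $\eta\colon M\otimes_B N\to A$ and $\rho\colon N\otimes_A M\to B$ respectively (these are 2-sided ideals). For a left $B$-module $W$, let $DW$ be the image of the $A$-homomorphism $$M\otimes_B W\to\operatorname{Hom}_B(N,W),\qquad m\otimes w\mapsto\bigl(n\mapsto\rho(n\otimes m)w\bigr).$$ Then $W\mapsto DW$ induces a one-to-one correspondence between $\operatorname{Irr}^J(B)$ and $\operatorname{Irr}^I(A)$.
   Context: A Morita context between algebras $A$ and $B$ is a pair of an $(A,B)$-bimodule $M$ and a $(B,A)$-bimodule $N$ equipped with bimodule homomorphisms $\eta\colon M\otimes_B N\to A$ and $\rho\colon N\otimes_A M\to B$ satisfying $\eta(x\otimes y)\cdot x'=x\cdot\rho(y\otimes x')$ and $\rho(y\otimes x)\cdot y'=y\cdot\eta(x\otimes y')$ for all $x,x'\in M$, $y,y'\in N$. $\operatorname{Irr}(A)$ is the set of isomorphism classes of simple left $A$-modules, and for a 2-sided ideal $I\subset A$, $\operatorname{Irr}^I(A)\subset\operatorname{Irr}(A)$ is the subset of those $V$ with $IV=V$. $\operatorname{Irr}^J(B)$ is defined similarly. The left $A$-action on $\operatorname{Hom}_B(N,W)$ is $(af)(n)=f(na)$. *)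

theory Defs
  imports "HOL-Algebra.Free_Abelian_Groups" "HOL-Algebra.Generated_Groups" "HOL-Algebra.Module" "HOL-Algebra.Ideal"
begin

text \<open>The library locale \<^locale>\<open>algebra\<close> is restricted to commutative algebras and
  \<^locale>\<open>module\<close> to commutative base rings, so the noncommutative versions are introduced here, on
  the library records.  As in the library, the fields \<^const>\<open>monoid.mult\<close> and \<^const>\<open>one\<close> of a record that
  is used as a module carry no meaning.\<close>

locale assoc_algebra = module R A + A?: ring A for R and A (structure) +
  assumes smult_mult_left:
      "\<lbrakk>c \<in> carrier R; x \<in> carrier A; y \<in> carrier A\<rbrakk> \<Longrightarrow> c \<odot> (x \<otimes> y) = (c \<odot> x) \<otimes> y"
    and smult_mult_right:
      "\<lbrakk>c \<in> carrier R; x \<in> carrier A; y \<in> carrier A\<rbrakk> \<Longrightarrow> c \<odot> (x \<otimes> y) = x \<otimes> (c \<odot> y)"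

locale left_module = A?: ring A + V?: abelian_group V
  for A :: "('a, 's) ring_scheme" and V :: "('a, 'v, 't) module_scheme" (structure) +
  assumes smult_closed [simp, intro]:
      "\<lbrakk>a \<in> carrier A; v \<in> carrier V\<rbrakk> \<Longrightarrow> a \<odot> v \<in> carrier V"
    and smult_l_distr:
      "\<lbrakk>a \<in> carrier A; b \<in> carrier A; v \<in> carrier V\<rbrakk> \<Longrightarrow>
        (a \<oplus>\<^bsub>A\<^esub> b) \<odot> v = a \<odot> v \<oplus> b \<odot> v"
    and smult_r_distr:
      "\<lbrakk>a \<in> carrier A; v \<in> carrier V; w \<in> carrier V\<rbrakk> \<Longrightarrow>
        a \<odot> (v \<oplus> w) = a \<odot> v \<oplus> a \<odot> w"
    and smult_assoc:
      "\<lbrakk>a \<in> carrier A; b \<in> carrier A; v \<in> carrier V\<rbrakk> \<Longrightarrow>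
        (a \<otimes>\<^bsub>A\<^esub> b) \<odot> v = a \<odot> (b \<odot> v)"
    and smult_one [simp]: "v \<in> carrier V \<Longrightarrow> \<one>\<^bsub>A\<^esub> \<odot> v = v"

definition left_module_hom ::
  "('a, 's) ring_scheme \<Rightarrow> ('a, 'v, 't) module_scheme \<Rightarrow> ('a, 'w, 'u) module_scheme \<Rightarrow> ('v \<Rightarrow> 'w) set"
  where "left_module_hom A V W =
    {f \<in> hom (add_monoid V) (add_monoid W).
       \<forall>a \<in> carrier A. \<forall>v \<in> carrier V. f (a \<odot>\<^bsub>V\<^esub> v) = a \<odot>\<^bsub>W\<^esub> f v}"

definition left_module_isomorphic ::
  "('a, 's) ring_scheme \<Rightarrow> ('a, 'v, 't) module_scheme \<Rightarrow> ('a, 'w, 'u) module_scheme \<Rightarrow> bool"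
  where "left_module_isomorphic A V W \<longleftrightarrow>
    (\<exists>f \<in> left_module_hom A V W. bij_betw f (carrier V) (carrier W))"

definition simple_left_module :: "('a, 's) ring_scheme \<Rightarrow> ('a, 'v, 't) module_scheme \<Rightarrow> bool"
  where "simple_left_module A V \<longleftrightarrow> left_module A V \<and> carrier V \<noteq> {\<zero>\<^bsub>V\<^esub>} \<and>
    (\<forall>U. submodule U A V \<longrightarrow> U = {\<zero>\<^bsub>V\<^esub>} \<or> U = carrier V)"

text \<open>\<open>IV\<close> consists of the finite sums of products \<open>i v\<close>.\<close>

definition ideal_smult :: "'a set \<Rightarrow> ('a, 'v, 't) module_scheme \<Rightarrow> 'v set"
  where "ideal_smult I V = generate (add_monoid V) {i \<odot>\<^bsub>V\<^esub> v | i v. i \<in> I \<and> v \<in> carrier V}"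

record ('a, 'm, 'b) bimodule = "('a, 'm) module" +
  rsmult :: "'m \<Rightarrow> 'b \<Rightarrow> 'm" (infixl \<open>\<star>\<index>\<close> 70)

text \<open>A common base ring of \<open>A\<close> and \<open>B\<close> is not required to act on both sides in the same way.\<close>

locale bimodule = left_module A M + B?: ring B
  for A :: "('a, 's) ring_scheme" and B :: "('b, 'r) ring_scheme"
    and M :: "('a, 'm, 'b, 't) bimodule_scheme" (structure) +
  assumes rsmult_closed [simp, intro]:
      "\<lbrakk>x \<in> carrier M; b \<in> carrier B\<rbrakk> \<Longrightarrow> x \<star> b \<in> carrier M"
    and rsmult_r_distr:
      "\<lbrakk>x \<in> carrier M; b \<in> carrier B; c \<in> carrier B\<rbrakk> \<Longrightarrow>
        x \<star> (b \<oplus>\<^bsub>B\<^esub> c) = x \<star> b \<oplus> x \<star> c"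
    and rsmult_l_distr:
      "\<lbrakk>x \<in> carrier M; y \<in> carrier M; b \<in> carrier B\<rbrakk> \<Longrightarrow>
        (x \<oplus> y) \<star> b = x \<star> b \<oplus> y \<star> b"
    and rsmult_assoc:
      "\<lbrakk>x \<in> carrier M; b \<in> carrier B; c \<in> carrier B\<rbrakk> \<Longrightarrow>
        x \<star> (b \<otimes>\<^bsub>B\<^esub> c) = (x \<star> b) \<star> c"
    and rsmult_one [simp]: "x \<in> carrier M \<Longrightarrow> x \<star> \<one>\<^bsub>B\<^esub> = x"
    and smult_rsmult:
      "\<lbrakk>a \<in> carrier A; x \<in> carrier M; b \<in> carrier B\<rbrakk> \<Longrightarrow> (a \<odot> x) \<star> b = a \<odot> (x \<star> b)"

definition bimodule_hom ::
  "('a, 's) ring_scheme \<Rightarrow> ('b, 't) ring_scheme \<Rightarrow> ('a, 'm, 'b, 'u) bimodule_scheme \<Rightarrow>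
    ('a, 'n, 'b, 'v) bimodule_scheme \<Rightarrow> ('m \<Rightarrow> 'n) set"
  where "bimodule_hom A B M N =
    {f \<in> left_module_hom A M N.
       \<forall>x \<in> carrier M. \<forall>b \<in> carrier B. f (x \<star>\<^bsub>M\<^esub> b) = f x \<star>\<^bsub>N\<^esub> b}"

definition regular_bimodule :: "('a, 's) ring_scheme \<Rightarrow> ('a, 'a, 'a) bimodule"
  where "regular_bimodule A =
    \<lparr>carrier = carrier A, monoid.mult = monoid.mult A, one = one A, ring.zero = ring.zero A, add = add A,
     smult = monoid.mult A, rsmult = monoid.mult A\<rparr>"

text \<open>\<open>M \<otimes>\<^sub>B W\<close> is the free abelian group on \<open>M \<times> W\<close> modulo biadditivity and
  \<open>x b \<otimes> w = x \<otimes> b w\<close>; its elements are cosets.\<close>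

definition tensor_relators ::
  "('a, 'm, 'b, 's) bimodule_scheme \<Rightarrow> ('b, 't) ring_scheme \<Rightarrow> ('b, 'w, 'u) module_scheme \<Rightarrow>
    ('m \<times> 'w \<Rightarrow>\<^sub>0 int) set"
  where "tensor_relators M B W =
    {frag_of (x \<oplus>\<^bsub>M\<^esub> x', w) - frag_of (x, w) - frag_of (x', w) | x x' w.
       x \<in> carrier M \<and> x' \<in> carrier M \<and> w \<in> carrier W}
    \<union> {frag_of (x, w \<oplus>\<^bsub>W\<^esub> w') - frag_of (x, w) - frag_of (x, w') | x w w'.
       x \<in> carrier M \<and> w \<in> carrier W \<and> w' \<in> carrier W}
    \<union> {frag_of (x \<star>\<^bsub>M\<^esub> b, w) - frag_of (x, b \<odot>\<^bsub>W\<^esub> w) | x b w.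
       x \<in> carrier M \<and> b \<in> carrier B \<and> w \<in> carrier W}"

abbreviation tensor_free ::
  "('a, 'm, 'b, 's) bimodule_scheme \<Rightarrow> ('b, 'w, 'u) module_scheme \<Rightarrow> ('m \<times> 'w \<Rightarrow>\<^sub>0 int) monoid"
  where "tensor_free M W \<equiv> free_Abelian_group (carrier M \<times> carrier W)"

definition tensor_kernel ::
  "('a, 'm, 'b, 's) bimodule_scheme \<Rightarrow> ('b, 't) ring_scheme \<Rightarrow> ('b, 'w, 'u) module_scheme \<Rightarrow>
    ('m \<times> 'w \<Rightarrow>\<^sub>0 int) set"
  where "tensor_kernel M B W = generate (tensor_free M W) (tensor_relators M B W)"

definition tensor_class ::
  "('a, 'm, 'b, 's) bimodule_scheme \<Rightarrow> ('b, 't) ring_scheme \<Rightarrow> ('b, 'w, 'u) module_scheme \<Rightarrow>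
    ('m \<times> 'w \<Rightarrow>\<^sub>0 int) \<Rightarrow> ('m \<times> 'w \<Rightarrow>\<^sub>0 int) set"
  where "tensor_class M B W t = tensor_kernel M B W #>\<^bsub>tensor_free M W\<^esub> t"

definition pure_tensor ::
  "('a, 'm, 'b, 's) bimodule_scheme \<Rightarrow> ('b, 't) ring_scheme \<Rightarrow> ('b, 'w, 'u) module_scheme \<Rightarrow>
    'm \<Rightarrow> 'w \<Rightarrow> ('m \<times> 'w \<Rightarrow>\<^sub>0 int) set"
  where "pure_tensor M B W x w = tensor_class M B W (frag_of (x, w))"

text \<open>The left action is \<open>a (x \<otimes> w) = a x \<otimes> w\<close>, extended additively; the union below runs over
  representatives of one coset and all its members coincide.\<close>

definition tensor ::
  "('a, 'm, 'b, 's) bimodule_scheme \<Rightarrow> ('b, 't) ring_scheme \<Rightarrow> ('b, 'w, 'u) module_scheme \<Rightarrow>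
    ('a, ('m \<times> 'w \<Rightarrow>\<^sub>0 int) set) module"
  where "tensor M B W =
    (let Q = tensor_free M W Mod tensor_kernel M B W in
    \<lparr>carrier = carrier Q, monoid.mult = undefined, one = undefined, ring.zero = \<one>\<^bsub>Q\<^esub>, add = monoid.mult Q,
     smult = (\<lambda>a T. \<Union>t\<in>T. tensor_class M B W
       (frag_extend (\<lambda>(x, w). frag_of (a \<odot>\<^bsub>M\<^esub> x, w)) t))\<rparr>)"

definition bitensor ::
  "('a, 'm, 'b, 's) bimodule_scheme \<Rightarrow> ('b, 't) ring_scheme \<Rightarrow> ('b, 'n, 'c, 'u) bimodule_scheme \<Rightarrow>
    ('a, ('m \<times> 'n \<Rightarrow>\<^sub>0 int) set, 'c) bimodule"
  where "bitensor M B N = module.extend (tensor M B N)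
    \<lparr>rsmult = (\<lambda>T c. \<Union>t\<in>T. tensor_class M B N
       (frag_extend (\<lambda>(x, y). frag_of (x, y \<star>\<^bsub>N\<^esub> c)) t))\<rparr>"

text \<open>For a balanced biadditive \<open>\<phi>\<close> into an abelian group, the additive map on the tensor product
  sending \<open>x \<otimes> w\<close> to \<open>\<phi> x w\<close>.\<close>

definition free_lift :: "('c, 's) ring_scheme \<Rightarrow> ('p \<Rightarrow> 'c) \<Rightarrow> ('p \<Rightarrow>\<^sub>0 int) \<Rightarrow> 'c"
  where "free_lift G f t =
    finsum G (\<lambda>p. add_pow G (Poly_Mapping.lookup t p) (f p)) (Poly_Mapping.keys t)"

definition tensor_lift ::
  "('c, 's) ring_scheme \<Rightarrow> ('m \<Rightarrow> 'w \<Rightarrow> 'c) \<Rightarrow> ('m \<times> 'w \<Rightarrow>\<^sub>0 int) set \<Rightarrow> 'c"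
  where "tensor_lift G \<phi> T = the_elem (free_lift G (\<lambda>(x, w). \<phi> x w) ` T)"

locale morita_context =
  M: bimodule A B M + N: bimodule B A N
  for A :: "('a, 's) ring_scheme" and B :: "('b, 't) ring_scheme"
    and M :: "('a, 'm, 'b, 'u) bimodule_scheme" and N :: "('b, 'n, 'a, 'v) bimodule_scheme"
    and \<eta> :: "('m \<times> 'n \<Rightarrow>\<^sub>0 int) set \<Rightarrow> 'a" and \<rho> :: "('n \<times> 'm \<Rightarrow>\<^sub>0 int) set \<Rightarrow> 'b" +
  assumes eta_hom: "\<eta> \<in> bimodule_hom A A (bitensor M B N) (regular_bimodule A)"
    and rho_hom: "\<rho> \<in> bimodule_hom B B (bitensor N A M) (regular_bimodule B)"
    and eta_rho:
      "\<lbrakk>x \<in> carrier M; y \<in> carrier N; x' \<in> carrier M\<rbrakk> \<Longrightarrow>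
        \<eta> (pure_tensor M B N x y) \<odot>\<^bsub>M\<^esub> x' = x \<star>\<^bsub>M\<^esub> \<rho> (pure_tensor N A M y x')"
    and rho_eta:
      "\<lbrakk>y \<in> carrier N; x \<in> carrier M; y' \<in> carrier N\<rbrakk> \<Longrightarrow>
        \<rho> (pure_tensor N A M y x) \<odot>\<^bsub>N\<^esub> y' = y \<star>\<^bsub>N\<^esub> \<eta> (pure_tensor M B N x y')"

text \<open>\<open>Hom\<^sub>B(N, W)\<close> with the action \<open>(a f)(n) = f(n a)\<close>.  Maps are extensional, so that equality of
  elements is equality on \<open>N\<close>.\<close>

definition hom_module ::
  "('b, 't) ring_scheme \<Rightarrow> ('b, 'n, 'a, 'v) bimodule_scheme \<Rightarrow> ('b, 'w, 'u) module_scheme \<Rightarrow>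
    ('a, 'n \<Rightarrow> 'w) module"
  where "hom_module B N W =
    \<lparr>carrier = left_module_hom B N W \<inter> extensional (carrier N),
     monoid.mult = undefined, one = undefined,
     ring.zero = (\<lambda>n\<in>carrier N. \<zero>\<^bsub>W\<^esub>),
     add = (\<lambda>f g. \<lambda>n\<in>carrier N. f n \<oplus>\<^bsub>W\<^esub> g n),
     smult = (\<lambda>a f. \<lambda>n\<in>carrier N. f (n \<star>\<^bsub>N\<^esub> a))\<rparr>"

definition morita_map ::
  "('a, 's) ring_scheme \<Rightarrow> ('b, 't) ring_scheme \<Rightarrow> ('a, 'm, 'b, 'p) bimodule_scheme \<Rightarrow>
    ('b, 'n, 'a, 'q) bimodule_scheme \<Rightarrow> (('n \<times> 'm \<Rightarrow>\<^sub>0 int) set \<Rightarrow> 'b) \<Rightarrow>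
    ('b, 'w, 'u) module_scheme \<Rightarrow> ('m \<times> 'w \<Rightarrow>\<^sub>0 int) set \<Rightarrow> ('n \<Rightarrow> 'w)"
  where "morita_map A B M N \<rho> W = tensor_lift (hom_module B N W)
    (\<lambda>m w. \<lambda>n\<in>carrier N. \<rho> (pure_tensor N A M n m) \<odot>\<^bsub>W\<^esub> w)"

definition morita_D ::
  "('a, 's) ring_scheme \<Rightarrow> ('b, 't) ring_scheme \<Rightarrow> ('a, 'm, 'b, 'p) bimodule_scheme \<Rightarrow>
    ('b, 'n, 'a, 'q) bimodule_scheme \<Rightarrow> (('n \<times> 'm \<Rightarrow>\<^sub>0 int) set \<Rightarrow> 'b) \<Rightarrow>
    ('b, 'w, 'u) module_scheme \<Rightarrow> ('a, 'n \<Rightarrow> 'w) module"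
  where "morita_D A B M N \<rho> W =
    (hom_module B N W)\<lparr>carrier := morita_map A B M N \<rho> W ` carrier (tensor M B W)\<rparr>"

text \<open>Modules over \<open>A\<close> may live on any type, whereas a set of isomorphism classes needs a fixed one.
  Every simple module is isomorphic to some \<open>A/L\<close> whose elements are cosets, i.e. of type
  \<^typ>\<open>'a set\<close>; so the class of \<open>V\<close> is recorded by the modules on that type isomorphic to \<open>V\<close>.  It is
  nonempty for every simple \<open>V\<close>, whatever its type: see \<open>iso_class_nonempty\<close> and
  \<open>iso_class_eq_iff\<close>.\<close>

definition iso_class ::
  "('a, 's) ring_scheme \<Rightarrow> ('a, 'v, 't) module_scheme \<Rightarrow> ('a, 'a set) module set"
  where "iso_class A V = {V'. left_module A V' \<and> left_module_isomorphic A V V'}"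

definition Irr :: "('a, 's) ring_scheme \<Rightarrow> ('a, 'a set) module set set"
  where "Irr A = {iso_class A V | V :: ('a, 'a set) module. simple_left_module A V}"

definition Irr_ideal :: "('a, 's) ring_scheme \<Rightarrow> 'a set \<Rightarrow> ('a, 'a set) module set set"
  where "Irr_ideal A I = {iso_class A V | V :: ('a, 'a set) module.
    simple_left_module A V \<and> ideal_smult I V = carrier V}"

lemma left_module_homI:
  assumes "\<And>v. v \<in> carrier V \<Longrightarrow> f v \<in> carrier W"
    and "\<And>v w. \<lbrakk>v \<in> carrier V; w \<in> carrier V\<rbrakk> \<Longrightarrow> f (v \<oplus>\<^bsub>V\<^esub> w) = f v \<oplus>\<^bsub>W\<^esub> f w"
    and "\<And>a v. \<lbrakk>a \<in> carrier A; v \<in> carrier V\<rbrakk> \<Longrightarrow> f (a \<odot>\<^bsub>V\<^esub> v) = a \<odot>\<^bsub>W\<^esub> f v"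
  shows "f \<in> left_module_hom A V W"
  using assms by (auto simp: left_module_hom_def hom_def)

lemma left_module_homD:
  assumes "f \<in> left_module_hom A V W"
  shows "\<And>v. v \<in> carrier V \<Longrightarrow> f v \<in> carrier W"
    and "\<And>v w. \<lbrakk>v \<in> carrier V; w \<in> carrier V\<rbrakk> \<Longrightarrow> f (v \<oplus>\<^bsub>V\<^esub> w) = f v \<oplus>\<^bsub>W\<^esub> f w"
    and "\<And>a v. \<lbrakk>a \<in> carrier A; v \<in> carrier V\<rbrakk> \<Longrightarrow> f (a \<odot>\<^bsub>V\<^esub> v) = a \<odot>\<^bsub>W\<^esub> f v"
  using assms by (auto simp: left_module_hom_def hom_def)

lemma left_moduleI:
  assumes "ring A" and "abelian_group V"
    and "\<And>a v. \<lbrakk>a \<in> carrier A; v \<in> carrier V\<rbrakk> \<Longrightarrow> a \<odot>\<^bsub>V\<^esub> v \<in> carrier V"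
    and "\<And>a b v. \<lbrakk>a \<in> carrier A; b \<in> carrier A; v \<in> carrier V\<rbrakk> \<Longrightarrow>
        (a \<oplus>\<^bsub>A\<^esub> b) \<odot>\<^bsub>V\<^esub> v = a \<odot>\<^bsub>V\<^esub> v \<oplus>\<^bsub>V\<^esub> b \<odot>\<^bsub>V\<^esub> v"
    and "\<And>a v w. \<lbrakk>a \<in> carrier A; v \<in> carrier V; w \<in> carrier V\<rbrakk> \<Longrightarrow>
        a \<odot>\<^bsub>V\<^esub> (v \<oplus>\<^bsub>V\<^esub> w) = a \<odot>\<^bsub>V\<^esub> v \<oplus>\<^bsub>V\<^esub> a \<odot>\<^bsub>V\<^esub> w"
    and "\<And>a b v. \<lbrakk>a \<in> carrier A; b \<in> carrier A; v \<in> carrier V\<rbrakk> \<Longrightarrow>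
        (a \<otimes>\<^bsub>A\<^esub> b) \<odot>\<^bsub>V\<^esub> v = a \<odot>\<^bsub>V\<^esub> (b \<odot>\<^bsub>V\<^esub> v)"
    and "\<And>v. v \<in> carrier V \<Longrightarrow> \<one>\<^bsub>A\<^esub> \<odot>\<^bsub>V\<^esub> v = v"
  shows "left_module A V"
  using assms unfolding left_module_def left_module_axioms_def by blast

lemma left_module_isomorphic_refl: "left_module_isomorphic A V V"
  unfolding left_module_isomorphic_def
  by (rule bexI[of _ id]) (auto intro: left_module_homI)

lemma left_module_isomorphic_sym:
  assumes V: "left_module A V" and iso: "left_module_isomorphic A V W"
  shows "left_module_isomorphic A W V"
proof -
  interpret V: left_module A V by (rule V)
  from iso obtain f where f: "f \<in> left_module_hom A V W" and b: "bij_betw f (carrier V) (carrier W)"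
    by (auto simp: left_module_isomorphic_def)
  let ?g = "inv_into (carrier V) f"
  have g: "?g w \<in> carrier V" "f (?g w) = w" if "w \<in> carrier W" for w
    using b that by (auto simp: bij_betw_def intro: inv_into_into f_inv_into_f)
  have gf: "?g (f v) = v" if "v \<in> carrier V" for v
    using b that by (auto simp: bij_betw_def)
  have "?g \<in> left_module_hom A W V"
  proof (rule left_module_homI)
    fix v w assume vw: "v \<in> carrier W" "w \<in> carrier W"
    have "v \<oplus>\<^bsub>W\<^esub> w = f (?g v \<oplus>\<^bsub>V\<^esub> ?g w)"
      using vw by (simp add: left_module_homD(2)[OF f] g)
    then show "?g (v \<oplus>\<^bsub>W\<^esub> w) = ?g v \<oplus>\<^bsub>V\<^esub> ?g w"
      using vw g by (simp add: gf)
  next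
    fix a w assume aw: "a \<in> carrier A" "w \<in> carrier W"
    have "a \<odot>\<^bsub>W\<^esub> w = f (a \<odot>\<^bsub>V\<^esub> ?g w)"
      using aw by (simp add: left_module_homD(3)[OF f] g)
    then show "?g (a \<odot>\<^bsub>W\<^esub> w) = a \<odot>\<^bsub>V\<^esub> ?g w"
      using aw g by (simp add: gf)
  qed (use g in auto)
  then show ?thesis
    using bij_betw_inv_into[OF b] by (auto simp: left_module_isomorphic_def)
qed

lemma left_module_isomorphic_trans:
  assumes "left_module_isomorphic A U V" and "left_module_isomorphic A V W"
  shows "left_module_isomorphic A U W"
proof -
  from assms obtain f g where f: "f \<in> left_module_hom A U V" "bij_betw f (carrier U) (carrier V)"
    and g: "g \<in> left_module_hom A V W" "bij_betw g (carrier V) (carrier W)"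
    by (auto simp: left_module_isomorphic_def)
  have "g \<circ> f \<in> left_module_hom A U W"
    by (rule left_module_homI) (simp_all add: left_module_homD[OF f(1)] left_module_homD[OF g(1)])
  then show ?thesis
    using bij_betw_trans[OF f(2) g(2)] by (auto simp: left_module_isomorphic_def)
qed

lemma left_module_transport:
  fixes V :: "('a, 'v, 't) module_scheme" and g :: "'v \<Rightarrow> 'w"
  assumes V: "left_module A V" and inj: "inj_on g (carrier V)"
  shows "\<exists>V' :: ('a, 'w) module. left_module A V' \<and> left_module_isomorphic A V V'"
proof -
  interpret V: left_module A V by (rule V)
  let ?h = "inv_into (carrier V) g"
  have h [simp]: "?h (g v) = v" if "v \<in> carrier V" for v
    using inj that by simp
  define V' :: "('a, 'w) module" where
    "V' = \<lparr>carrier = g ` carrier V, monoid.mult = undefined, one = undefined, ring.zero = g \<zero>\<^bsub>V\<^esub>,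
      add = (\<lambda>x y. g (?h x \<oplus>\<^bsub>V\<^esub> ?h y)), smult = (\<lambda>a x. g (a \<odot>\<^bsub>V\<^esub> ?h x))\<rparr>"
  have "abelian_group V'"
  proof (rule abelian_groupI)
    fix x assume "x \<in> carrier V'"
    then obtain v where v: "v \<in> carrier V" "x = g v" by (auto simp: V'_def)
    show "\<exists>y\<in>carrier V'. y \<oplus>\<^bsub>V'\<^esub> x = \<zero>\<^bsub>V'\<^esub>"
      by (rule bexI[of _ "g (\<ominus>\<^bsub>V\<^esub> v)"]) (use v in \<open>auto simp: V'_def V.l_neg\<close>)
  qed (auto simp: V'_def V.a_ac)
  then have "left_module A V'"
    by (intro left_moduleI V.A.ring_axioms)
      (auto simp: V'_def V.smult_l_distr V.smult_r_distr V.smult_assoc)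
  moreover have "g \<in> left_module_hom A V V'"
    by (rule left_module_homI) (auto simp: V'_def)
  moreover have "bij_betw g (carrier V) (carrier V')"
    using inj by (simp add: bij_betw_def V'_def)
  ultimately show ?thesis
    by (auto simp: left_module_isomorphic_def)
qed

lemma (in left_module) smult_zero_left: "v \<in> carrier V \<Longrightarrow> \<zero>\<^bsub>A\<^esub> \<odot> v = \<zero>"
  by (metis A.l_zero A.zero_closed V.add.l_cancel_one smult_closed smult_l_distr)

lemma (in left_module) submodule_cyclic:
  assumes v: "v \<in> carrier V"
  shows "submodule ((\<lambda>a. a \<odot> v) ` carrier A) A V"
proof -
  have inv: "\<ominus> (a \<odot> v) = (\<ominus>\<^bsub>A\<^esub> a) \<odot> v" if "a \<in> carrier A" for a
    by (rule V.minus_equality)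
      (use v that in \<open>simp_all add: smult_zero_left A.l_neg flip: smult_l_distr\<close>)
  show ?thesis
  proof (intro submodule.intro subgroup.intro submodule_axioms.intro)
    fix x y assume "x \<in> (\<lambda>a. a \<odot> v) ` carrier A" "y \<in> (\<lambda>a. a \<odot> v) ` carrier A"
    then obtain a b where "a \<in> carrier A" "b \<in> carrier A" "x = a \<odot> v" "y = b \<odot> v" by auto
    then show "x \<otimes>\<^bsub>add_monoid V\<^esub> y \<in> (\<lambda>a. a \<odot> v) ` carrier A"
      using v by (auto simp flip: smult_l_distr)
  next
    show "\<one>\<^bsub>add_monoid V\<^esub> \<in> (\<lambda>a. a \<odot> v) ` carrier A"
      using v by (auto simp: smult_zero_left intro!: image_eqI[of _ _ "\<zero>\<^bsub>A\<^esub>"])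
  next
    fix x assume "x \<in> (\<lambda>a. a \<odot> v) ` carrier A"
    then show "inv\<^bsub>add_monoid V\<^esub> x \<in> (\<lambda>a. a \<odot> v) ` carrier A"
      using inv by (auto simp flip: a_inv_def)
  next
    fix a x assume a: "a \<in> carrier A" and "x \<in> (\<lambda>a. a \<odot> v) ` carrier A"
    then obtain b where "b \<in> carrier A" "x = b \<odot> v" by auto
    then show "a \<odot> x \<in> (\<lambda>a. a \<odot> v) ` carrier A"
      using v a by (auto simp flip: smult_assoc)
  qed (use v in auto)
qed

lemma iso_class_nonempty:
  assumes V: "simple_left_module A V"
  shows "iso_class A V \<noteq> {}"
proof -
  interpret V: left_module A V
    using V by (simp add: simple_left_module_def)
  obtain v where v: "v \<in> carrier V" "v \<noteq> \<zero>\<^bsub>V\<^esub>"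
    using V V.zero_closed by (auto simp: simple_left_module_def)
  have "v \<in> (\<lambda>a. a \<odot>\<^bsub>V\<^esub> v) ` carrier A"
    using v by (intro image_eqI[of _ _ "\<one>\<^bsub>A\<^esub>"]) auto
  then have gen: "(\<lambda>a. a \<odot>\<^bsub>V\<^esub> v) ` carrier A = carrier V"
    using V V.submodule_cyclic[OF v(1)] v(2) by (auto simp: simple_left_module_def)
  have "inj_on (\<lambda>u. {a \<in> carrier A. a \<odot>\<^bsub>V\<^esub> v = u}) (carrier V)"
    unfolding gen[symmetric] by (auto simp: inj_on_def)
  then show ?thesis
    using left_module_transport[OF V.left_module_axioms] by (auto simp: iso_class_def)
qed

lemma iso_class_eq_iff:
  assumes V: "simple_left_module A V" and W: "simple_left_module A W"
  shows "iso_class A V = iso_class A W \<longleftrightarrow> left_module_isomorphic A V W"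
proof
  have VW: "left_module A V" "left_module A W"
    using V W by (simp_all add: simple_left_module_def)
  show "left_module_isomorphic A V W" if eq: "iso_class A V = iso_class A W"
  proof -
    obtain U where U: "U \<in> iso_class A V" "U \<in> iso_class A W"
      using iso_class_nonempty[OF V] eq by auto
    then have U: "left_module_isomorphic A V U" "left_module_isomorphic A W U"
      by (simp_all add: iso_class_def)
    show ?thesis
      by (rule left_module_isomorphic_trans[OF U(1) left_module_isomorphic_sym[OF VW(2) U(2)]])
  qed
  show "iso_class A V = iso_class A W" if iso: "left_module_isomorphic A V W"
    using left_module_isomorphic_trans[OF iso]
      left_module_isomorphic_trans[OF left_module_isomorphic_sym[OF VW(1) iso]]
    by (auto simp: iso_class_def)
qed

locale tensor_pair = M: bimodule A B M + W: left_module B W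
  for A :: "('a, 's) ring_scheme" and B :: "('b, 't) ring_scheme"
    and M :: "('a, 'm, 'b, 'u) bimodule_scheme" and W :: "('b, 'w, 'v) module_scheme"
begin

abbreviation "FMW \<equiv> tensor_free M W"
abbreviation "KMW \<equiv> tensor_kernel M B W"

lemma relatorE [consumes 1, case_names l r b]:
  assumes "t \<in> tensor_relators M B W"
  obtains x x' w where "t = frag_of (x \<oplus>\<^bsub>M\<^esub> x', w) - frag_of (x, w) - frag_of (x', w)"
      "x \<in> carrier M" "x' \<in> carrier M" "w \<in> carrier W"
    | x w w' where "t = frag_of (x, w \<oplus>\<^bsub>W\<^esub> w') - frag_of (x, w) - frag_of (x, w')"
      "x \<in> carrier M" "w \<in> carrier W" "w' \<in> carrier W"
    | x b w where "t = frag_of (x \<star>\<^bsub>M\<^esub> b, w) - frag_of (x, b \<odot>\<^bsub>W\<^esub> w)"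
      "x \<in> carrier M" "b \<in> carrier B" "w \<in> carrier W"
  using assms unfolding tensor_relators_def by blast

lemma relatorI:
  "\<lbrakk>x \<in> carrier M; x' \<in> carrier M; w \<in> carrier W\<rbrakk> \<Longrightarrow>
    frag_of (x \<oplus>\<^bsub>M\<^esub> x', w) - frag_of (x, w) - frag_of (x', w) \<in> tensor_relators M B W"
  "\<lbrakk>x \<in> carrier M; w \<in> carrier W; w' \<in> carrier W\<rbrakk> \<Longrightarrow>
    frag_of (x, w \<oplus>\<^bsub>W\<^esub> w') - frag_of (x, w) - frag_of (x, w') \<in> tensor_relators M B W"
  "\<lbrakk>x \<in> carrier M; b \<in> carrier B; w \<in> carrier W\<rbrakk> \<Longrightarrow>
    frag_of (x \<star>\<^bsub>M\<^esub> b, w) - frag_of (x, b \<odot>\<^bsub>W\<^esub> w) \<in> tensor_relators M B W"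
  unfolding tensor_relators_def by blast+

lemma relators_subset: "tensor_relators M B W \<subseteq> carrier FMW"
proof
  fix t assume "t \<in> tensor_relators M B W"
  then show "t \<in> carrier FMW"
    by (cases rule: relatorE) (auto dest!: subsetD[OF keys_diff])
qed

lemma kernel_subgroup: "subgroup KMW FMW"
  unfolding tensor_kernel_def
  by (intro group.generate_is_subgroup relators_subset group_free_Abelian_group)

lemma kernel_normal: "KMW \<lhd> FMW"
  by (intro comm_group.normal_iff_subgroup[THEN iffD2] abelian_free_Abelian_group kernel_subgroup)

lemma kernel_keys: "t \<in> KMW \<Longrightarrow> Poly_Mapping.keys t \<subseteq> carrier M \<times> carrier W"
  using subgroup.mem_carrier[OF kernel_subgroup] by simp

lemma tensor_class_eq_iff:
  assumes "t \<in> carrier FMW" and "t' \<in> carrier FMW"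
  shows "tensor_class M B W t = tensor_class M B W t' \<longleftrightarrow> t - t' \<in> KMW"
proof -
  have "t \<in> tensor_class M B W t' \<longleftrightarrow> t - t' \<in> KMW"
    unfolding tensor_class_def r_coset_def
    by (auto simp: algebra_simps) (metis add.commute diff_add_cancel)
  then show ?thesis
    unfolding tensor_class_def
    by (metis assms group.repr_independence group.rcos_self group_free_Abelian_group kernel_subgroup)
qed

lemma tensor_carrier: "carrier (tensor M B W) = tensor_class M B W ` carrier FMW"
  by (auto simp: tensor_def Let_def FactGroup_def RCOSETS_def tensor_class_def)

lemma tensor_zero: "\<zero>\<^bsub>tensor M B W\<^esub> = tensor_class M B W 0"
  by (simp add: tensor_def Let_def FactGroup_def tensor_class_def r_coset_def)

lemma tensor_add:
  assumes "t \<in> carrier FMW" and "t' \<in> carrier FMW"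
  shows "tensor_class M B W t \<oplus>\<^bsub>tensor M B W\<^esub> tensor_class M B W t' = tensor_class M B W (t + t')"
  using normal.rcos_sum[OF kernel_normal assms]
  by (simp add: tensor_def Let_def FactGroup_def tensor_class_def)

lemma tensor_abelian_group: "abelian_group (tensor M B W)"
proof (rule abelian_groupI)
  fix x assume "x \<in> carrier (tensor M B W)"
  then obtain t where t: "t \<in> carrier FMW" "x = tensor_class M B W t" by (auto simp: tensor_carrier)
  have "-t \<in> carrier FMW" using t(1) by simp
  then show "\<exists>y\<in>carrier (tensor M B W). y \<oplus>\<^bsub>tensor M B W\<^esub> x = \<zero>\<^bsub>tensor M B W\<^esub>"
    using t by (intro bexI[of _ "tensor_class M B W (-t)"])
      (simp_all add: tensor_add tensor_zero tensor_carrier)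
next
  fix x y z assume "x \<in> carrier (tensor M B W)" "y \<in> carrier (tensor M B W)" "z \<in> carrier (tensor M B W)"
  then obtain t u v where tuv: "t \<in> carrier FMW" "u \<in> carrier FMW" "v \<in> carrier FMW"
    "x = tensor_class M B W t" "y = tensor_class M B W u" "z = tensor_class M B W v"
    by (auto simp: tensor_carrier)
  have tu: "t + u \<in> carrier FMW" and uv: "u + v \<in> carrier FMW"
    using tuv(1-3) keys_add[of t u] keys_add[of u v] by auto
  show "x \<oplus>\<^bsub>tensor M B W\<^esub> y \<in> carrier (tensor M B W)"
    using tuv tu by (simp only: tensor_add) (auto simp: tensor_carrier)
  show "x \<oplus>\<^bsub>tensor M B W\<^esub> y \<oplus>\<^bsub>tensor M B W\<^esub> z = x \<oplus>\<^bsub>tensor M B W\<^esub> (y \<oplus>\<^bsub>tensor M B W\<^esub> z)"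
    using tuv tu uv by (simp only: tensor_add add.assoc)
  show "x \<oplus>\<^bsub>tensor M B W\<^esub> y = y \<oplus>\<^bsub>tensor M B W\<^esub> x"
    using tuv by (simp only: tensor_add add.commute)
next
  fix x assume "x \<in> carrier (tensor M B W)"
  then obtain t where t: "t \<in> carrier FMW" "x = tensor_class M B W t" by (auto simp: tensor_carrier)
  have "0 \<in> carrier FMW" by simp
  then show "\<zero>\<^bsub>tensor M B W\<^esub> \<oplus>\<^bsub>tensor M B W\<^esub> x = x"
    using t by (simp only: tensor_zero tensor_add add_0)
qed (auto simp: tensor_zero tensor_carrier)

lemma pure_tensor_closed:
  "\<lbrakk>x \<in> carrier M; w \<in> carrier W\<rbrakk> \<Longrightarrow> pure_tensor M B W x w \<in> carrier (tensor M B W)"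
  by (auto simp: pure_tensor_def tensor_carrier)

lemma pure_tensor_add_left:
  assumes "x \<in> carrier M" and "x' \<in> carrier M" and "w \<in> carrier W"
  shows "pure_tensor M B W (x \<oplus>\<^bsub>M\<^esub> x') w =
    pure_tensor M B W x w \<oplus>\<^bsub>tensor M B W\<^esub> pure_tensor M B W x' w"
proof -
  have "frag_of (x \<oplus>\<^bsub>M\<^esub> x', w) - (frag_of (x, w) + frag_of (x', w)) \<in> KMW"
    unfolding tensor_kernel_def tensor_relators_def
    by (rule generate.incl) (use assms in \<open>auto simp: diff_diff_add[symmetric]\<close>)
  moreover have "frag_of (x, w) + frag_of (x', w) \<in> carrier FMW"
    using assms by (auto dest!: subsetD[OF keys_add])
  ultimately show ?thesis
    using assms by (simp add: pure_tensor_def tensor_add tensor_class_eq_iff)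
qed

lemma pure_tensor_add_right:
  assumes "x \<in> carrier M" and "w \<in> carrier W" and "w' \<in> carrier W"
  shows "pure_tensor M B W x (w \<oplus>\<^bsub>W\<^esub> w') =
    pure_tensor M B W x w \<oplus>\<^bsub>tensor M B W\<^esub> pure_tensor M B W x w'"
proof -
  have "frag_of (x, w \<oplus>\<^bsub>W\<^esub> w') - (frag_of (x, w) + frag_of (x, w')) \<in> KMW"
    unfolding tensor_kernel_def tensor_relators_def
    by (rule generate.incl) (use assms in \<open>auto simp: diff_diff_add[symmetric]\<close>)
  moreover have "frag_of (x, w) + frag_of (x, w') \<in> carrier FMW"
    using assms by (auto dest!: subsetD[OF keys_add])
  ultimately show ?thesis
    using assms by (simp add: pure_tensor_def tensor_add tensor_class_eq_iff)
qed

lemma pure_tensor_balanced: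
  assumes "x \<in> carrier M" and "b \<in> carrier B" and "w \<in> carrier W"
  shows "pure_tensor M B W (x \<star>\<^bsub>M\<^esub> b) w = pure_tensor M B W x (b \<odot>\<^bsub>W\<^esub> w)"
proof -
  have "frag_of (x \<star>\<^bsub>M\<^esub> b, w) - frag_of (x, b \<odot>\<^bsub>W\<^esub> w) \<in> KMW"
    unfolding tensor_kernel_def tensor_relators_def
    by (rule generate.incl) (use assms in auto)
  then show ?thesis
    using assms by (simp add: pure_tensor_def tensor_class_eq_iff)
qed

lemma tensor_induct [consumes 1, case_names zero diff pure]:
  assumes "\<tau> \<in> carrier (tensor M B W)"
    and "P \<zero>\<^bsub>tensor M B W\<^esub>"
    and diff: "\<And>\<sigma> \<tau>. \<lbrakk>\<sigma> \<in> carrier (tensor M B W); \<tau> \<in> carrier (tensor M B W); P \<sigma>; P \<tau>\<rbrakk> \<Longrightarrow>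
      P (\<sigma> \<ominus>\<^bsub>tensor M B W\<^esub> \<tau>)"
    and "\<And>x w. \<lbrakk>x \<in> carrier M; w \<in> carrier W\<rbrakk> \<Longrightarrow> P (pure_tensor M B W x w)"
  shows "P \<tau>"
proof -
  interpret T: abelian_group "tensor M B W" by (rule tensor_abelian_group)
  from assms(1) obtain t where t: "t \<in> carrier FMW" "\<tau> = tensor_class M B W t"
    by (auto simp: tensor_carrier)
  from t(1) have "Poly_Mapping.keys t \<subseteq> carrier M \<times> carrier W" by simp
  then have "P (tensor_class M B W t)"
  proof (rule free_Abelian_group_induct[where P = "\<lambda>t. P (tensor_class M B W t)"])
    fix s t :: "'m \<times> 'w \<Rightarrow>\<^sub>0 int"
    assume 3: "Poly_Mapping.keys s \<subseteq> carrier M \<times> carrier W" "Poly_Mapping.keys t \<subseteq> carrier M \<times> carrier W"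
      "P (tensor_class M B W s)" "P (tensor_class M B W t)"
    have "s - t \<in> carrier FMW"
      using 3 keys_diff[of s t] by auto
    then have eq: "tensor_class M B W (s - t) \<oplus>\<^bsub>tensor M B W\<^esub> tensor_class M B W t = tensor_class M B W s"
      using 3 by (simp add: tensor_add)
    have cl: "tensor_class M B W (s - t) \<in> carrier (tensor M B W)" "tensor_class M B W t \<in> carrier (tensor M B W)"
      using 3 \<open>s - t \<in> carrier FMW\<close> by (auto simp: tensor_carrier)
    have "tensor_class M B W (s - t) = tensor_class M B W s \<ominus>\<^bsub>tensor M B W\<^esub> tensor_class M B W t"
      unfolding eq[symmetric] using cl by (simp add: T.minus_eq T.a_assoc T.r_neg)
    then show "P (tensor_class M B W (s - t))"
      using 3 by (auto intro!: diff simp: tensor_carrier)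
  qed (use assms in \<open>auto simp: tensor_zero pure_tensor_def\<close>)
  then show ?thesis using t by simp
qed

text \<open>Additive endomorphisms of the free group that preserve the relators act on the tensor
  product.\<close>

lemma tensor_endo:
  assumes cl: "\<And>x w. \<lbrakk>x \<in> carrier M; w \<in> carrier W\<rbrakk> \<Longrightarrow> f (x, w) \<in> carrier M \<times> carrier W"
    and rel: "\<And>r. r \<in> tensor_relators M B W \<Longrightarrow> frag_extend (frag_of \<circ> f) r \<in> KMW"
    and t: "t \<in> carrier FMW"
  shows "(\<Union>s\<in>tensor_class M B W t. tensor_class M B W (frag_extend (frag_of \<circ> f) s)) =
    tensor_class M B W (frag_extend (frag_of \<circ> f) t)"
    and "frag_extend (frag_of \<circ> f) t \<in> carrier FMW"
proof -
  have clo: "frag_extend (frag_of \<circ> f) s \<in> carrier FMW" if "s \<in> carrier FMW" for s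
  proof -
    have "f ` Poly_Mapping.keys s \<subseteq> carrier M \<times> carrier W"
    proof safe
      fix x w y v assume xw: "(x, w) \<in> Poly_Mapping.keys s" and eq: "(y, v) = f (x, w)"
      have "x \<in> carrier M" "w \<in> carrier W"
        using that xw by auto
      then have "(y, v) \<in> carrier M \<times> carrier W"
        unfolding eq by (rule cl)
      then show "y \<in> carrier M" "v \<in> carrier W" by auto
    qed
    moreover have "Poly_Mapping.keys (frag_extend (frag_of \<circ> f) s) \<subseteq> f ` Poly_Mapping.keys s"
      by (rule order_trans[OF keys_frag_extend]) (auto simp: keys_frag_of)
    ultimately show ?thesis by simp
  qed
  have ker: "frag_extend (frag_of \<circ> f) r \<in> KMW" if "r \<in> KMW" for r
    using that unfolding tensor_kernel_def
  proof (induction rule: generate.induct)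
    case one
    then show ?case by (auto intro: generate.one[of FMW, simplified])
  next
    case (incl h)
    show ?case by (rule rel[OF incl, unfolded tensor_kernel_def])
  next
    case (inv h)
    have "h \<in> carrier FMW" using inv relators_subset by blast
    then have "inv\<^bsub>FMW\<^esub> h = - h" by simp
    moreover have "- frag_extend (frag_of \<circ> f) h \<in> KMW"
      using subgroup.m_inv_closed[OF kernel_subgroup rel[OF inv]] kernel_keys[OF rel[OF inv]] by simp
    ultimately show ?case by (simp only: frag_extend_minus tensor_kernel_def)
  next
    case (eng h1 h2)
    then show ?case
      using subgroup.m_closed[OF kernel_subgroup, of "frag_extend (frag_of \<circ> f) h1" "frag_extend (frag_of \<circ> f) h2"]
      by (simp only: frag_extend_add tensor_kernel_def mult_free_Abelian_group)
  qed
  have const: "tensor_class M B W (frag_extend (frag_of \<circ> f) s) = tensor_class M B W (frag_extend (frag_of \<circ> f) t)"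
    if s: "s \<in> tensor_class M B W t" for s
  proof -
    obtain k where k: "k \<in> KMW" "s = k + t"
      using s by (auto simp: tensor_class_def r_coset_def)
    have kF: "k \<in> carrier FMW" using kernel_keys[OF k(1)] by simp
    have sF: "s \<in> carrier FMW"
      using kF t keys_add[of k t] k(2) by auto
    have "frag_extend (frag_of \<circ> f) s - frag_extend (frag_of \<circ> f) t = frag_extend (frag_of \<circ> f) k"
      by (simp only: k(2) frag_extend_add add_diff_cancel_right')
    then show ?thesis
      using tensor_class_eq_iff[OF clo[OF sF] clo[OF t]] ker[OF k(1)] by (simp only:)
  qed
  have mem: "t \<in> tensor_class M B W t"
    unfolding tensor_class_def
    by (rule group.rcos_self[OF group_free_Abelian_group t kernel_subgroup])
  have "(\<Union>s\<in>tensor_class M B W t. tensor_class M B W (frag_extend (frag_of \<circ> f) s)) =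
    (\<Union>s\<in>tensor_class M B W t. tensor_class M B W (frag_extend (frag_of \<circ> f) t))"
    by (rule SUP_cong[OF refl]) (rule const)
  also have "\<dots> = tensor_class M B W (frag_extend (frag_of \<circ> f) t)"
    using mem by (metis UN_constant empty_iff)
  finally show "(\<Union>s\<in>tensor_class M B W t. tensor_class M B W (frag_extend (frag_of \<circ> f) s)) =
    tensor_class M B W (frag_extend (frag_of \<circ> f) t)" .
  show "frag_extend (frag_of \<circ> f) t \<in> carrier FMW"
    by (rule clo[OF t])
qed

lemma rel_smult:
  assumes a: "a \<in> carrier A" and r: "r \<in> tensor_relators M B W"
  shows "frag_extend (frag_of \<circ> (\<lambda>(x, w). (a \<odot>\<^bsub>M\<^esub> x, w))) r \<in> tensor_relators M B W"
  using r
proof (cases rule: relatorE)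
  case (l x x' w)
  then show ?thesis
    using a relatorI(1)[of "a \<odot>\<^bsub>M\<^esub> x" "a \<odot>\<^bsub>M\<^esub> x'" w]
    by (simp add: frag_extend_diff M.smult_r_distr)
next
  case (r x w w')
  then show ?thesis
    using a relatorI(2)[of "a \<odot>\<^bsub>M\<^esub> x" w w'] by (simp add: frag_extend_diff)
next
  case (b x c w)
  then show ?thesis
    using a relatorI(3)[of "a \<odot>\<^bsub>M\<^esub> x" c w]
    by (simp add: frag_extend_diff flip: M.smult_rsmult)
qed

lemma smult_fun_eq:
  "(\<lambda>(x, w). frag_of (a \<odot>\<^bsub>M\<^esub> x, w)) = frag_of \<circ> (\<lambda>(x, w). (a \<odot>\<^bsub>M\<^esub> x, w))"
  by auto

lemma tensor_smult_class:
  assumes a: "a \<in> carrier A" and t: "t \<in> carrier FMW"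
  shows "a \<odot>\<^bsub>tensor M B W\<^esub> tensor_class M B W t =
      tensor_class M B W (frag_extend (\<lambda>(x, w). frag_of (a \<odot>\<^bsub>M\<^esub> x, w)) t)"
    and "frag_extend (\<lambda>(x, w). frag_of (a \<odot>\<^bsub>M\<^esub> x, w)) t \<in> carrier FMW"
  using tensor_endo[of "\<lambda>(x, w). (a \<odot>\<^bsub>M\<^esub> x, w)", OF _ _ t] rel_smult[OF a] a
  by (auto simp: tensor_def Let_def smult_fun_eq tensor_kernel_def intro: generate.incl)

lemma tensor_smult_pure:
  assumes "a \<in> carrier A" and "x \<in> carrier M" and "w \<in> carrier W"
  shows "a \<odot>\<^bsub>tensor M B W\<^esub> pure_tensor M B W x w = pure_tensor M B W (a \<odot>\<^bsub>M\<^esub> x) w"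
  using assms by (simp add: pure_tensor_def tensor_smult_class)

lemma tensor_smult_r_distr:
  assumes "a \<in> carrier A" and "\<sigma> \<in> carrier (tensor M B W)" and "\<tau> \<in> carrier (tensor M B W)"
  shows "a \<odot>\<^bsub>tensor M B W\<^esub> (\<sigma> \<oplus>\<^bsub>tensor M B W\<^esub> \<tau>) =
    a \<odot>\<^bsub>tensor M B W\<^esub> \<sigma> \<oplus>\<^bsub>tensor M B W\<^esub> a \<odot>\<^bsub>tensor M B W\<^esub> \<tau>"
proof -
  obtain s t where st: "s \<in> carrier FMW" "t \<in> carrier FMW" "\<sigma> = tensor_class M B W s"
    "\<tau> = tensor_class M B W t"
    using assms by (auto simp: tensor_carrier)
  have "s + t \<in> carrier FMW"
    using st keys_add[of s t] by auto
  then show ?thesis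
    using st(1,2) tensor_smult_class(2)[OF assms(1) st(1)] tensor_smult_class(2)[OF assms(1) st(2)]
    unfolding st(3,4)
    by (simp only: tensor_add tensor_smult_class[OF assms(1)] frag_extend_add)
qed

end

lemma (in abelian_group) finsum_add_pow_superset:
  assumes "f ` S \<subseteq> carrier G" and "finite F" and "F \<subseteq> S" and "Poly_Mapping.keys t \<subseteq> F"
  shows "free_lift G f t = finsum G (\<lambda>p. add_pow G (Poly_Mapping.lookup t p) (f p)) F"
  unfolding free_lift_def
proof (rule add.finprod_mono_neutral_cong_left)
  show "[Poly_Mapping.lookup t i] \<cdot> f i = \<zero>" if "i \<in> F - Poly_Mapping.keys t" for i
    using that by (auto simp: in_keys_iff add_pow_def)
  show "(\<lambda>p. [Poly_Mapping.lookup t p] \<cdot> f p) \<in> F \<rightarrow> carrier G"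
    using assms by (auto intro!: add.int_pow_closed)
qed (use assms in auto)

lemma (in abelian_group) free_lift_add:
  assumes "f ` S \<subseteq> carrier G" and "Poly_Mapping.keys s \<subseteq> S" and "Poly_Mapping.keys t \<subseteq> S"
  shows "free_lift G f (s + t) = free_lift G f s \<oplus> free_lift G f t"
proof -
  let ?F = "Poly_Mapping.keys s \<union> Poly_Mapping.keys t"
  have cl: "f p \<in> carrier G" if "p \<in> ?F" for p
    using assms that by auto
  have "free_lift G f (s + t) = finsum G (\<lambda>p. [Poly_Mapping.lookup (s + t) p] \<cdot> f p) ?F"
    by (rule finsum_add_pow_superset[OF assms(1)]) (use assms keys_add[of s t] in auto)
  also have "\<dots> = finsum G (\<lambda>p. [Poly_Mapping.lookup s p] \<cdot> f p \<oplus> [Poly_Mapping.lookup t p] \<cdot> f p) ?F"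
    by (rule add.finprod_cong') (auto simp: lookup_add add.int_pow_mult cl intro!: add.int_pow_closed)
  also have "\<dots> = finsum G (\<lambda>p. [Poly_Mapping.lookup s p] \<cdot> f p) ?F \<oplus>
      finsum G (\<lambda>p. [Poly_Mapping.lookup t p] \<cdot> f p) ?F"
    by (rule finsum_addf) (auto intro!: add.int_pow_closed cl)
  also have "\<dots> = free_lift G f s \<oplus> free_lift G f t"
    using finsum_add_pow_superset[OF assms(1), of ?F] assms by simp
  finally show ?thesis .
qed

lemma (in abelian_group) free_lift_closed:
  assumes "f ` S \<subseteq> carrier G" and "Poly_Mapping.keys t \<subseteq> S"
  shows "free_lift G f t \<in> carrier G"
  unfolding free_lift_def using assms by (intro finsum_closed) (auto intro!: add.int_pow_closed)

lemma (in abelian_group) free_lift_of: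
  assumes "f p \<in> carrier G"
  shows "free_lift G f (frag_of p) = f p"
proof -
  have "add_pow G (1::int) (f p) = f p"
    using assms by (rule add.int_pow_1)
  then show ?thesis
    using assms by (simp add: free_lift_def finsum_insert[of "{}" p, simplified])
qed

lemma (in abelian_group) free_lift_zero: "free_lift G f 0 = \<zero>"
  by (simp add: free_lift_def)

lemma (in abelian_group) free_lift_minus:
  assumes "f ` S \<subseteq> carrier G" and "Poly_Mapping.keys t \<subseteq> S"
  shows "free_lift G f (- t) = \<ominus> free_lift G f t"
proof -
  have "free_lift G f (- t) \<oplus> free_lift G f t = \<zero>"
    using free_lift_add[OF assms(1), of "- t" t] assms by (simp add: free_lift_zero)
  then show ?thesis
    using free_lift_closed[OF assms(1), of t] free_lift_closed[OF assms(1), of "- t"] assms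
    by (simp add: minus_equality)
qed

lemma (in abelian_group) free_lift_diff:
  assumes "f ` S \<subseteq> carrier G" and "Poly_Mapping.keys s \<subseteq> S" and "Poly_Mapping.keys t \<subseteq> S"
  shows "free_lift G f (s - t) = free_lift G f s \<ominus> free_lift G f t"
  using free_lift_add[OF assms(1), of s "- t"] free_lift_minus[OF assms(1), of t] assms
  by (simp add: minus_eq)

lemma (in abelian_group) add_minus_minus:
  assumes "p \<in> carrier G" and "q \<in> carrier G"
  shows "p \<oplus> q \<ominus> p \<ominus> q = \<zero>"
proof -
  have "p \<oplus> q \<ominus> p = q"
    using assms a_comm[of p q] by (simp add: minus_eq a_assoc r_neg)
  then show ?thesis using assms by (simp add: minus_eq r_neg)
qed

locale balanced_map = tensor_pair A B M W + G: abelian_group G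
  for A :: "('a, 's) ring_scheme" and B :: "('b, 't) ring_scheme"
    and M :: "('a, 'm, 'b, 'u) bimodule_scheme" and W :: "('b, 'w, 'v) module_scheme"
    and G :: "('c, 'r) ring_scheme" +
  fixes \<phi> :: "'m \<Rightarrow> 'w \<Rightarrow> 'c"
  assumes phi_closed: "\<lbrakk>x \<in> carrier M; w \<in> carrier W\<rbrakk> \<Longrightarrow> \<phi> x w \<in> carrier G"
    and phi_add_left: "\<lbrakk>x \<in> carrier M; x' \<in> carrier M; w \<in> carrier W\<rbrakk> \<Longrightarrow>
      \<phi> (x \<oplus>\<^bsub>M\<^esub> x') w = \<phi> x w \<oplus>\<^bsub>G\<^esub> \<phi> x' w"
    and phi_add_right: "\<lbrakk>x \<in> carrier M; w \<in> carrier W; w' \<in> carrier W\<rbrakk> \<Longrightarrow>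
      \<phi> x (w \<oplus>\<^bsub>W\<^esub> w') = \<phi> x w \<oplus>\<^bsub>G\<^esub> \<phi> x w'"
    and phi_balanced: "\<lbrakk>x \<in> carrier M; b \<in> carrier B; w \<in> carrier W\<rbrakk> \<Longrightarrow>
      \<phi> (x \<star>\<^bsub>M\<^esub> b) w = \<phi> x (b \<odot>\<^bsub>W\<^esub> w)"
begin

abbreviation "lft \<equiv> free_lift G (\<lambda>(x, w). \<phi> x w)"

lemma img: "(\<lambda>(x, w). \<phi> x w) ` (carrier M \<times> carrier W) \<subseteq> carrier G"
  by (auto intro: phi_closed)

lemma lft_relator:
  assumes "t \<in> tensor_relators M B W"
  shows "lft t = \<zero>\<^bsub>G\<^esub>"
  using assms
proof (cases rule: relatorE)
  case (l x x' w)
  have "Poly_Mapping.keys (frag_of (x \<oplus>\<^bsub>M\<^esub> x', w) - frag_of (x, w)) \<subseteq> carrier M \<times> carrier W"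
    by (rule order_trans[OF keys_diff]) (use l in auto)
  then show ?thesis
    using l by (simp add: G.free_lift_diff[OF img] G.free_lift_of phi_closed phi_add_left G.add_minus_minus)
next
  case (r x w w')
  have "Poly_Mapping.keys (frag_of (x, w \<oplus>\<^bsub>W\<^esub> w') - frag_of (x, w)) \<subseteq> carrier M \<times> carrier W"
    by (rule order_trans[OF keys_diff]) (use r in auto)
  then show ?thesis
    using r by (simp add: G.free_lift_diff[OF img] G.free_lift_of phi_closed phi_add_right G.add_minus_minus)
next
  case (b x c w)
  then show ?thesis
    by (simp add: G.free_lift_diff[OF img] G.free_lift_of phi_closed phi_balanced G.r_neg G.minus_eq)
qed

lemma lft_kernel:
  assumes "k \<in> KMW"
  shows "lft k = \<zero>\<^bsub>G\<^esub>"
  using assms unfolding tensor_kernel_def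
proof (induction rule: generate.induct)
  case one
  then show ?case by (simp add: G.free_lift_zero)
next
  case (incl h)
  then show ?case by (rule lft_relator)
next
  case (inv h)
  then have "Poly_Mapping.keys h \<subseteq> carrier M \<times> carrier W"
    using subsetD[OF relators_subset] by simp
  then show ?case using inv by (simp add: G.free_lift_minus[OF img] lft_relator)
next
  case (eng h1 h2)
  then have "Poly_Mapping.keys h1 \<subseteq> carrier M \<times> carrier W" "Poly_Mapping.keys h2 \<subseteq> carrier M \<times> carrier W"
    by (auto simp flip: tensor_kernel_def dest: kernel_keys)
  then show ?case using eng by (simp add: G.free_lift_add[OF img])
qed

lemma tensor_lift_class:
  assumes t: "t \<in> carrier FMW"
  shows "tensor_lift G \<phi> (tensor_class M B W t) = lft t"
proof -
  have "lft s = lft t" if s: "s \<in> tensor_class M B W t" for s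
  proof -
    obtain k where k: "k \<in> KMW" "s = k + t"
      using s by (auto simp: tensor_class_def r_coset_def)
    then show ?thesis
      using t G.free_lift_closed[OF img, of t]
      by (simp add: G.free_lift_add[OF img] kernel_keys lft_kernel)
  qed
  moreover have "t \<in> tensor_class M B W t"
    unfolding tensor_class_def
    by (rule group.rcos_self[OF group_free_Abelian_group t kernel_subgroup])
  ultimately have "lft ` tensor_class M B W t = {lft t}"
    by blast
  then show ?thesis by (simp add: tensor_lift_def)
qed

lemma tensor_lift_pure:
  "\<lbrakk>x \<in> carrier M; w \<in> carrier W\<rbrakk> \<Longrightarrow> tensor_lift G \<phi> (pure_tensor M B W x w) = \<phi> x w"
  by (simp add: pure_tensor_def tensor_lift_class G.free_lift_of phi_closed)

lemma tensor_lift_hom: "tensor_lift G \<phi> \<in> hom (add_monoid (tensor M B W)) (add_monoid G)"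
proof (rule homI)
  fix x assume "x \<in> carrier (add_monoid (tensor M B W))"
  then show "tensor_lift G \<phi> x \<in> carrier (add_monoid G)"
    by (auto simp: tensor_carrier tensor_lift_class G.free_lift_closed[OF img])
next
  fix x y assume "x \<in> carrier (add_monoid (tensor M B W))" "y \<in> carrier (add_monoid (tensor M B W))"
  then obtain s t where st: "s \<in> carrier FMW" "t \<in> carrier FMW"
    "x = tensor_class M B W s" "y = tensor_class M B W t"
    by (auto simp: tensor_carrier)
  have "s + t \<in> carrier FMW" using st(1,2) keys_add[of s t] by auto
  then show "tensor_lift G \<phi> (x \<otimes>\<^bsub>add_monoid (tensor M B W)\<^esub> y) =
    tensor_lift G \<phi> x \<otimes>\<^bsub>add_monoid G\<^esub> tensor_lift G \<phi> y"
    using st(1,2) G.free_lift_add[OF img, of s t]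
    unfolding st(3,4) by (simp add: tensor_add tensor_lift_class del: carrier_free_Abelian_group_iff) simp
qed

end

context tensor_pair
begin

lemma tensor_hom_eqI:
  assumes G: "abelian_group G"
    and f: "f \<in> hom (add_monoid (tensor M B W)) (add_monoid G)"
    and g: "g \<in> hom (add_monoid (tensor M B W)) (add_monoid G)"
    and eq: "\<And>x w. \<lbrakk>x \<in> carrier M; w \<in> carrier W\<rbrakk> \<Longrightarrow>
      f (pure_tensor M B W x w) = g (pure_tensor M B W x w)"
    and "\<tau> \<in> carrier (tensor M B W)"
  shows "f \<tau> = g \<tau>"
proof -
  interpret T: abelian_group "tensor M B W" by (rule tensor_abelian_group)
  have h_diff: "h (\<sigma> \<ominus>\<^bsub>tensor M B W\<^esub> \<tau>) = h \<sigma> \<ominus>\<^bsub>G\<^esub> h \<tau>" and h_zero: "h \<zero>\<^bsub>tensor M B W\<^esub> = \<zero>\<^bsub>G\<^esub>"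
    if h: "h \<in> hom (add_monoid (tensor M B W)) (add_monoid G)"
      and "\<sigma> \<in> carrier (tensor M B W)" "\<tau> \<in> carrier (tensor M B W)" for h \<sigma> \<tau>
  proof -
    have h: "group_hom (add_monoid (tensor M B W)) (add_monoid G) h"
      by (intro group_hom.intro group_hom_axioms.intro T.a_group abelian_group.a_group G h)
    show "h (\<sigma> \<ominus>\<^bsub>tensor M B W\<^esub> \<tau>) = h \<sigma> \<ominus>\<^bsub>G\<^esub> h \<tau>"
      using group_hom.hom_inv[OF h, folded a_inv_def, of \<tau>]
        group_hom.hom_mult[OF h, of \<sigma> "\<ominus>\<^bsub>tensor M B W\<^esub> \<tau>"] that T.a_inv_closed[of \<tau>]
      by (simp add: a_minus_def)
    show "h \<zero>\<^bsub>tensor M B W\<^esub> = \<zero>\<^bsub>G\<^esub>"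
      using group_hom.hom_one[OF h] by simp
  qed
  from assms(5) show ?thesis
  proof (induction rule: tensor_induct)
    case (diff \<sigma> \<tau>)
    then show ?case by (simp only: h_diff[OF f] h_diff[OF g])
  next
    case zero
    show ?case by (simp only: h_zero[OF f T.zero_closed T.zero_closed] h_zero[OF g T.zero_closed T.zero_closed])
  next
    case (pure x w)
    then show ?case by (rule eq)
  qed
qed

lemma tensor_smult_closed:
  "\<lbrakk>a \<in> carrier A; \<tau> \<in> carrier (tensor M B W)\<rbrakk> \<Longrightarrow> a \<odot>\<^bsub>tensor M B W\<^esub> \<tau> \<in> carrier (tensor M B W)"
  using tensor_smult_class by (auto simp: tensor_carrier)

lemma tensor_smult_hom:
  "a \<in> carrier A \<Longrightarrow> (\<lambda>\<tau>. a \<odot>\<^bsub>tensor M B W\<^esub> \<tau>) \<in>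
    hom (add_monoid (tensor M B W)) (add_monoid (tensor M B W))"
  by (rule homI) (simp_all add: tensor_smult_closed tensor_smult_r_distr)

lemma tensor_left_module: "left_module A (tensor M B W)"
proof -
  interpret T: abelian_group "tensor M B W" by (rule tensor_abelian_group)
  show ?thesis
  proof (rule left_moduleI)
    fix a b \<tau> assume a: "a \<in> carrier A" and b: "b \<in> carrier A" and t: "\<tau> \<in> carrier (tensor M B W)"
    show "(a \<oplus>\<^bsub>A\<^esub> b) \<odot>\<^bsub>tensor M B W\<^esub> \<tau> =
      a \<odot>\<^bsub>tensor M B W\<^esub> \<tau> \<oplus>\<^bsub>tensor M B W\<^esub> b \<odot>\<^bsub>tensor M B W\<^esub> \<tau>"
      using a b t
      by (intro tensor_hom_eqI[OF tensor_abelian_group tensor_smult_hom _ _ t] homI)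
        (simp_all add: tensor_smult_closed tensor_smult_r_distr T.a_ac tensor_smult_pure
          M.smult_l_distr pure_tensor_add_left)
    show "(a \<otimes>\<^bsub>A\<^esub> b) \<odot>\<^bsub>tensor M B W\<^esub> \<tau> = a \<odot>\<^bsub>tensor M B W\<^esub> (b \<odot>\<^bsub>tensor M B W\<^esub> \<tau>)"
      using a b t
      by (intro tensor_hom_eqI[OF tensor_abelian_group tensor_smult_hom _ _ t] homI)
        (simp_all add: tensor_smult_closed tensor_smult_r_distr tensor_smult_pure M.smult_assoc)
  next
    fix \<tau> assume t: "\<tau> \<in> carrier (tensor M B W)"
    show "\<one>\<^bsub>A\<^esub> \<odot>\<^bsub>tensor M B W\<^esub> \<tau> = \<tau>"
      by (intro tensor_hom_eqI[OF tensor_abelian_group tensor_smult_hom _ _ t] homI)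
        (simp_all add: tensor_smult_pure)
  qed (simp_all add: M.A.ring_axioms tensor_abelian_group tensor_smult_closed tensor_smult_r_distr)
qed

end

lemma bitensor_simps [simp]:
  "carrier (bitensor M B N) = carrier (tensor M B N)"
  "\<zero>\<^bsub>bitensor M B N\<^esub> = \<zero>\<^bsub>tensor M B N\<^esub>"
  "x \<oplus>\<^bsub>bitensor M B N\<^esub> y = x \<oplus>\<^bsub>tensor M B N\<^esub> y"
  "a \<odot>\<^bsub>bitensor M B N\<^esub> x = a \<odot>\<^bsub>tensor M B N\<^esub> x"
  by (simp_all add: bitensor_def module.defs)

locale bitensor_pair = M: bimodule A B M + N: bimodule B C N
  for A :: "('a, 's) ring_scheme" and B :: "('b, 't) ring_scheme" and C :: "('c, 'r) ring_scheme"
    and M :: "('a, 'm, 'b, 'u) bimodule_scheme" and N :: "('b, 'n, 'c, 'v) bimodule_scheme"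
begin

sublocale tensor_pair A B M N
  by unfold_locales

lemma rel_rsmult:
  assumes c: "c \<in> carrier C" and r: "r \<in> tensor_relators M B N"
  shows "frag_extend (frag_of \<circ> (\<lambda>(x, y). (x, y \<star>\<^bsub>N\<^esub> c))) r \<in> tensor_relators M B N"
  using r
proof (cases rule: relatorE)
  case (l x x' w)
  then show ?thesis
    using c relatorI(1)[of x x' "w \<star>\<^bsub>N\<^esub> c"] by (simp add: frag_extend_diff)
next
  case (r x w w')
  then show ?thesis
    using c relatorI(2)[of x "w \<star>\<^bsub>N\<^esub> c" "w' \<star>\<^bsub>N\<^esub> c"]
    by (simp add: frag_extend_diff N.rsmult_l_distr)
next
  case (b x e w)
  then show ?thesis
    using c relatorI(3)[of x e "w \<star>\<^bsub>N\<^esub> c"]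
    by (simp add: frag_extend_diff N.smult_rsmult)
qed

lemma rsmult_fun_eq:
  "(\<lambda>(x, y). frag_of (x, y \<star>\<^bsub>N\<^esub> c)) = frag_of \<circ> (\<lambda>(x, y). (x, y \<star>\<^bsub>N\<^esub> c))"
  by auto

lemma tensor_rsmult_class:
  assumes c: "c \<in> carrier C" and t: "t \<in> carrier FMW"
  shows "tensor_class M B N t \<star>\<^bsub>bitensor M B N\<^esub> c =
      tensor_class M B N (frag_extend (\<lambda>(x, y). frag_of (x, y \<star>\<^bsub>N\<^esub> c)) t)"
    and "frag_extend (\<lambda>(x, y). frag_of (x, y \<star>\<^bsub>N\<^esub> c)) t \<in> carrier FMW"
  using tensor_endo[of "\<lambda>(x, y). (x, y \<star>\<^bsub>N\<^esub> c)", OF _ _ t] rel_rsmult[OF c] c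
  by (auto simp: bitensor_def module.defs rsmult_fun_eq tensor_kernel_def intro: generate.incl)

lemma tensor_rsmult_pure:
  assumes "c \<in> carrier C" and "x \<in> carrier M" and "y \<in> carrier N"
  shows "pure_tensor M B N x y \<star>\<^bsub>bitensor M B N\<^esub> c = pure_tensor M B N x (y \<star>\<^bsub>N\<^esub> c)"
  using assms by (simp add: pure_tensor_def tensor_rsmult_class)

lemma tensor_rsmult_closed:
  "\<lbrakk>c \<in> carrier C; \<tau> \<in> carrier (tensor M B N)\<rbrakk> \<Longrightarrow> \<tau> \<star>\<^bsub>bitensor M B N\<^esub> c \<in> carrier (tensor M B N)"
  using tensor_rsmult_class by (auto simp: tensor_carrier)

lemma tensor_rsmult_l_distr:
  assumes "c \<in> carrier C" and "\<sigma> \<in> carrier (tensor M B N)" and "\<tau> \<in> carrier (tensor M B N)"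
  shows "(\<sigma> \<oplus>\<^bsub>tensor M B N\<^esub> \<tau>) \<star>\<^bsub>bitensor M B N\<^esub> c =
    \<sigma> \<star>\<^bsub>bitensor M B N\<^esub> c \<oplus>\<^bsub>tensor M B N\<^esub> \<tau> \<star>\<^bsub>bitensor M B N\<^esub> c"
proof -
  obtain s t where st: "s \<in> carrier FMW" "t \<in> carrier FMW" "\<sigma> = tensor_class M B N s"
    "\<tau> = tensor_class M B N t"
    using assms by (auto simp: tensor_carrier)
  have "s + t \<in> carrier FMW"
    using st keys_add[of s t] by auto
  then show ?thesis
    using st(1,2) tensor_rsmult_class(2)[OF assms(1) st(1)] tensor_rsmult_class(2)[OF assms(1) st(2)]
    unfolding st(3,4)
    by (simp only: tensor_add tensor_rsmult_class[OF assms(1)] frag_extend_add)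
qed

lemma tensor_rsmult_hom:
  "c \<in> carrier C \<Longrightarrow> (\<lambda>\<tau>. \<tau> \<star>\<^bsub>bitensor M B N\<^esub> c) \<in>
    hom (add_monoid (tensor M B N)) (add_monoid (tensor M B N))"
  by (rule homI) (simp_all add: tensor_rsmult_closed tensor_rsmult_l_distr)

lemma bitensor_bimodule: "bimodule A C (bitensor M B N)"
proof -
  interpret T: left_module A "tensor M B N" by (rule tensor_left_module)
  have "left_module A (bitensor M B N)"
  proof (rule left_moduleI)
    show "abelian_group (bitensor M B N)"
      by (rule abelian_groupI) (auto simp: T.a_ac intro: T.l_neg)
  qed (simp_all add: M.A.ring_axioms T.smult_l_distr T.smult_r_distr T.smult_assoc)
  moreover have "bimodule_axioms A C (bitensor M B N)"
  proof (rule bimodule_axioms.intro; simp only: bitensor_simps)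
    fix \<tau> c d assume t: "\<tau> \<in> carrier (tensor M B N)" and c: "c \<in> carrier C" and d: "d \<in> carrier C"
    show "\<tau> \<star>\<^bsub>bitensor M B N\<^esub> (c \<oplus>\<^bsub>C\<^esub> d) =
      \<tau> \<star>\<^bsub>bitensor M B N\<^esub> c \<oplus>\<^bsub>tensor M B N\<^esub> \<tau> \<star>\<^bsub>bitensor M B N\<^esub> d"
      using c d t
      by (intro tensor_hom_eqI[OF tensor_abelian_group tensor_rsmult_hom _ _ t] homI)
        (simp_all add: tensor_rsmult_closed tensor_rsmult_l_distr T.a_ac tensor_rsmult_pure
          N.rsmult_r_distr pure_tensor_add_right)
    show "\<tau> \<star>\<^bsub>bitensor M B N\<^esub> (c \<otimes>\<^bsub>C\<^esub> d) = \<tau> \<star>\<^bsub>bitensor M B N\<^esub> c \<star>\<^bsub>bitensor M B N\<^esub> d"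
      using c d t
      by (intro tensor_hom_eqI[OF tensor_abelian_group tensor_rsmult_hom _ _ t] homI)
        (simp_all add: tensor_rsmult_closed tensor_rsmult_l_distr tensor_rsmult_pure N.rsmult_assoc)
  next
    fix \<tau> assume t: "\<tau> \<in> carrier (tensor M B N)"
    show "\<tau> \<star>\<^bsub>bitensor M B N\<^esub> \<one>\<^bsub>C\<^esub> = \<tau>"
      by (intro tensor_hom_eqI[OF tensor_abelian_group tensor_rsmult_hom _ _ t] homI)
        (simp_all add: tensor_rsmult_pure)
  next
    fix a \<tau> c assume a: "a \<in> carrier A" and t: "\<tau> \<in> carrier (tensor M B N)" and c: "c \<in> carrier C"
    show "(a \<odot>\<^bsub>tensor M B N\<^esub> \<tau>) \<star>\<^bsub>bitensor M B N\<^esub> c = a \<odot>\<^bsub>tensor M B N\<^esub> (\<tau> \<star>\<^bsub>bitensor M B N\<^esub> c)"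
      using a c
      by (intro tensor_hom_eqI[OF tensor_abelian_group _ _ _ t,
            where f = "\<lambda>\<tau>. (a \<odot>\<^bsub>tensor M B N\<^esub> \<tau>) \<star>\<^bsub>bitensor M B N\<^esub> c"] homI)
        (simp_all add: tensor_rsmult_closed tensor_rsmult_l_distr T.smult_r_distr
          tensor_rsmult_pure tensor_smult_pure)
  qed (simp_all add: tensor_rsmult_closed tensor_rsmult_l_distr)
  ultimately show ?thesis
    by (intro bimodule.intro N.B.ring_axioms)
qed

end

lemma (in left_module) smult_zero_right: "a \<in> carrier A \<Longrightarrow> a \<odot> \<zero> = \<zero>"
  by (metis V.l_zero V.zero_closed V.add.l_cancel_one smult_closed smult_r_distr)

lemma (in left_module) smult_minus_right:
  assumes "a \<in> carrier A" and "v \<in> carrier V"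
  shows "a \<odot> (\<ominus> v) = \<ominus> (a \<odot> v)"
proof -
  have "a \<odot> (\<ominus> v) \<oplus> a \<odot> v = \<zero>"
    using assms smult_r_distr[of a "\<ominus> v" v] by (simp add: V.l_neg smult_zero_right)
  then show ?thesis using assms by (simp add: V.minus_equality)
qed

lemma hom_module_closedI:
  assumes "\<And>n. n \<in> carrier N \<Longrightarrow> f n \<in> carrier W"
    and "\<And>n n'. \<lbrakk>n \<in> carrier N; n' \<in> carrier N\<rbrakk> \<Longrightarrow> f (n \<oplus>\<^bsub>N\<^esub> n') = f n \<oplus>\<^bsub>W\<^esub> f n'"
    and "\<And>b n. \<lbrakk>b \<in> carrier B; n \<in> carrier N\<rbrakk> \<Longrightarrow> f (b \<odot>\<^bsub>N\<^esub> n) = b \<odot>\<^bsub>W\<^esub> f n"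
    and "left_module B N"
  shows "(\<lambda>n\<in>carrier N. f n) \<in> carrier (hom_module B N W)"
proof -
  interpret N: left_module B N by (rule assms(4))
  show ?thesis
    using assms(1-3) by (auto simp: hom_module_def intro!: left_module_homI)
qed

lemma hom_module_left_module:
  assumes N: "bimodule B A N" and W: "left_module B W"
  shows "left_module A (hom_module B N W)"
proof -
  interpret N: bimodule B A N by (rule N)
  interpret W: left_module B W by (rule W)
  have D2: "f (n \<oplus>\<^bsub>N\<^esub> n') = f n \<oplus>\<^bsub>W\<^esub> f n'"
    if "f \<in> carrier (hom_module B N W)" "n \<in> carrier N" "n' \<in> carrier N" for f n n'
    using that by (auto simp: hom_module_def dest: left_module_homD)
  have D3: "f (b \<odot>\<^bsub>N\<^esub> n) = b \<odot>\<^bsub>W\<^esub> f n"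
    if "f \<in> carrier (hom_module B N W)" "n \<in> carrier N" "b \<in> carrier B" for f n b
    using that by (auto simp: hom_module_def dest: left_module_homD)
  have ext: "f \<in> extensional (carrier N)" if "f \<in> carrier (hom_module B N W)" for f
    using that by (simp add: hom_module_def)
  have eqI: "f = g" if "f \<in> extensional (carrier N)" "g \<in> extensional (carrier N)"
    "\<And>n. n \<in> carrier N \<Longrightarrow> f n = g n" for f g :: "_ \<Rightarrow> _"
    using that by (rule extensionalityI)
  have Dc: "f n \<in> carrier W" if "f \<in> carrier (hom_module B N W)" "n \<in> carrier N" for f n
    using that by (auto simp: hom_module_def dest: left_module_homD)
  have addc: "f \<oplus>\<^bsub>hom_module B N W\<^esub> g \<in> carrier (hom_module B N W)"
    if "f \<in> carrier (hom_module B N W)" "g \<in> carrier (hom_module B N W)" for f g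
  proof -
    have "(\<lambda>n\<in>carrier N. f n \<oplus>\<^bsub>W\<^esub> g n) \<in> carrier (hom_module B N W)"
      by (rule hom_module_closedI) (use that N.left_module_axioms in
        \<open>simp_all add: Dc D2 D3 W.a_ac W.smult_r_distr\<close>)
    then show ?thesis by (simp add: hom_module_def)
  qed
  have ev: "(f \<oplus>\<^bsub>hom_module B N W\<^esub> g) n = f n \<oplus>\<^bsub>W\<^esub> g n" "(a \<odot>\<^bsub>hom_module B N W\<^esub> f) n = f (n \<star>\<^bsub>N\<^esub> a)"
    "\<zero>\<^bsub>hom_module B N W\<^esub> n = \<zero>\<^bsub>W\<^esub>" if "n \<in> carrier N" for f g a n
    using that by (simp_all add: hom_module_def)
  have exts: "f \<oplus>\<^bsub>hom_module B N W\<^esub> g \<in> extensional (carrier N)"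
    "a \<odot>\<^bsub>hom_module B N W\<^esub> f \<in> extensional (carrier N)"
    "\<zero>\<^bsub>hom_module B N W\<^esub> \<in> extensional (carrier N)" for f g a
    by (simp_all add: hom_module_def)
  have zc: "\<zero>\<^bsub>hom_module B N W\<^esub> \<in> carrier (hom_module B N W)"
    using hom_module_closedI[of N "\<lambda>_. \<zero>\<^bsub>W\<^esub>" W B] N.left_module_axioms
    by (simp add: hom_module_def W.smult_zero_right)
  have sc: "a \<odot>\<^bsub>hom_module B N W\<^esub> f \<in> carrier (hom_module B N W)"
    if "f \<in> carrier (hom_module B N W)" "a \<in> carrier A" for a f
  proof -
    have "(\<lambda>n\<in>carrier N. f (n \<star>\<^bsub>N\<^esub> a)) \<in> carrier (hom_module B N W)"
      by (rule hom_module_closedI) (use that N.left_module_axioms in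
        \<open>simp_all add: Dc D2 D3 N.rsmult_l_distr N.smult_rsmult\<close>)
    then show ?thesis by (simp add: hom_module_def)
  qed
  have "abelian_group (hom_module B N W)"
  proof (rule abelian_groupI)
    fix f assume f: "f \<in> carrier (hom_module B N W)"
    let ?g = "\<lambda>n\<in>carrier N. \<ominus>\<^bsub>W\<^esub> f n"
    have "?g \<in> carrier (hom_module B N W)"
      by (rule hom_module_closedI) (use f N.left_module_axioms in
        \<open>simp_all add: Dc D2 D3 W.minus_add W.smult_minus_right\<close>)
    moreover have "?g \<oplus>\<^bsub>hom_module B N W\<^esub> f = \<zero>\<^bsub>hom_module B N W\<^esub>"
      by (rule eqI) (simp_all add: exts ev Dc f W.l_neg)
    ultimately show "\<exists>g\<in>carrier (hom_module B N W). g \<oplus>\<^bsub>hom_module B N W\<^esub> f = \<zero>\<^bsub>hom_module B N W\<^esub>"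
      by blast
  next
    fix f g h assume f: "f \<in> carrier (hom_module B N W)" and g: "g \<in> carrier (hom_module B N W)"
      and h: "h \<in> carrier (hom_module B N W)"
    show "f \<oplus>\<^bsub>hom_module B N W\<^esub> g \<oplus>\<^bsub>hom_module B N W\<^esub> h = f \<oplus>\<^bsub>hom_module B N W\<^esub> (g \<oplus>\<^bsub>hom_module B N W\<^esub> h)"
      by (rule eqI) (simp_all add: exts ev Dc f g h W.a_assoc)
    show "f \<oplus>\<^bsub>hom_module B N W\<^esub> g = g \<oplus>\<^bsub>hom_module B N W\<^esub> f"
      by (rule eqI) (simp_all add: exts ev Dc f g W.a_comm)
  next
    fix f assume f: "f \<in> carrier (hom_module B N W)"
    show "\<zero>\<^bsub>hom_module B N W\<^esub> \<oplus>\<^bsub>hom_module B N W\<^esub> f = f"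
      by (rule eqI) (simp_all add: exts ext ev Dc f)
  qed (simp_all add: addc zc)
  then show ?thesis
  proof (intro left_moduleI N.B.ring_axioms sc)
    fix a b f assume a: "a \<in> carrier A" and b: "b \<in> carrier A" and f: "f \<in> carrier (hom_module B N W)"
    show "(a \<oplus>\<^bsub>A\<^esub> b) \<odot>\<^bsub>hom_module B N W\<^esub> f =
      a \<odot>\<^bsub>hom_module B N W\<^esub> f \<oplus>\<^bsub>hom_module B N W\<^esub> b \<odot>\<^bsub>hom_module B N W\<^esub> f"
      by (rule eqI) (simp_all add: exts ev a b f N.rsmult_r_distr D2)
    show "(a \<otimes>\<^bsub>A\<^esub> b) \<odot>\<^bsub>hom_module B N W\<^esub> f = a \<odot>\<^bsub>hom_module B N W\<^esub> (b \<odot>\<^bsub>hom_module B N W\<^esub> f)"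
      by (rule eqI) (simp_all add: exts ev a b f N.rsmult_assoc)
  next
    fix a f g assume a: "a \<in> carrier A"
    show "a \<odot>\<^bsub>hom_module B N W\<^esub> (f \<oplus>\<^bsub>hom_module B N W\<^esub> g) =
      a \<odot>\<^bsub>hom_module B N W\<^esub> f \<oplus>\<^bsub>hom_module B N W\<^esub> a \<odot>\<^bsub>hom_module B N W\<^esub> g"
      by (rule eqI) (simp_all add: exts ev a)
  next
    fix f assume f: "f \<in> carrier (hom_module B N W)"
    show "\<one>\<^bsub>A\<^esub> \<odot>\<^bsub>hom_module B N W\<^esub> f = f"
      by (rule eqI) (simp_all add: exts ext ev f)
  qed
qed

context morita_context
begin

sublocale MN: bitensor_pair A B A M N by unfold_locales
sublocale NM: bitensor_pair B A B N M by unfold_locales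

lemma rho_closed: "\<tau> \<in> carrier (tensor N A M) \<Longrightarrow> \<rho> \<tau> \<in> carrier B"
  and rho_add: "\<lbrakk>\<sigma> \<in> carrier (tensor N A M); \<tau> \<in> carrier (tensor N A M)\<rbrakk> \<Longrightarrow>
    \<rho> (\<sigma> \<oplus>\<^bsub>tensor N A M\<^esub> \<tau>) = \<rho> \<sigma> \<oplus>\<^bsub>B\<^esub> \<rho> \<tau>"
  and rho_smult: "\<lbrakk>b \<in> carrier B; \<tau> \<in> carrier (tensor N A M)\<rbrakk> \<Longrightarrow>
    \<rho> (b \<odot>\<^bsub>tensor N A M\<^esub> \<tau>) = b \<otimes>\<^bsub>B\<^esub> \<rho> \<tau>"
  and rho_rsmult: "\<lbrakk>b \<in> carrier B; \<tau> \<in> carrier (tensor N A M)\<rbrakk> \<Longrightarrow>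
    \<rho> (\<tau> \<star>\<^bsub>bitensor N A M\<^esub> b) = \<rho> \<tau> \<otimes>\<^bsub>B\<^esub> b"
  using rho_hom
  by (auto simp: bimodule_hom_def left_module_hom_def hom_def regular_bimodule_def)

lemma eta_closed: "\<tau> \<in> carrier (tensor M B N) \<Longrightarrow> \<eta> \<tau> \<in> carrier A"
  and eta_add: "\<lbrakk>\<sigma> \<in> carrier (tensor M B N); \<tau> \<in> carrier (tensor M B N)\<rbrakk> \<Longrightarrow>
    \<eta> (\<sigma> \<oplus>\<^bsub>tensor M B N\<^esub> \<tau>) = \<eta> \<sigma> \<oplus>\<^bsub>A\<^esub> \<eta> \<tau>"
  and eta_smult: "\<lbrakk>a \<in> carrier A; \<tau> \<in> carrier (tensor M B N)\<rbrakk> \<Longrightarrow>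
    \<eta> (a \<odot>\<^bsub>tensor M B N\<^esub> \<tau>) = a \<otimes>\<^bsub>A\<^esub> \<eta> \<tau>"
  and eta_rsmult: "\<lbrakk>a \<in> carrier A; \<tau> \<in> carrier (tensor M B N)\<rbrakk> \<Longrightarrow>
    \<eta> (\<tau> \<star>\<^bsub>bitensor M B N\<^esub> a) = \<eta> \<tau> \<otimes>\<^bsub>A\<^esub> a"
  using eta_hom
  by (auto simp: bimodule_hom_def left_module_hom_def hom_def regular_bimodule_def)

lemma sym_context: "morita_context B A N M \<rho> \<eta>"
  by unfold_locales (simp_all add: rho_hom eta_hom eta_rho rho_eta)

lemma eta_image_ideal: "ideal (\<eta> ` carrier (bitensor M B N)) A"
proof -
  interpret T: left_module A "tensor M B N" by (rule MN.tensor_left_module)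
  have h: "group_hom (add_monoid (tensor M B N)) (add_monoid A) \<eta>"
    by (intro group_hom.intro group_hom_axioms.intro T.a_group M.A.a_group)
      (auto simp: hom_def eta_closed eta_add)
  have "subgroup (\<eta> ` carrier (tensor M B N)) (add_monoid A)"
    using group_hom.img_is_subgroup[OF h] by simp
  then show ?thesis
  proof (intro idealI M.A.ring_axioms; simp)
    fix i x assume i: "i \<in> \<eta> ` carrier (tensor M B N)" and x: "x \<in> carrier A"
    show "x \<otimes>\<^bsub>A\<^esub> i \<in> \<eta> ` carrier (tensor M B N)"
      using i x by (auto simp flip: eta_smult)
    show "i \<otimes>\<^bsub>A\<^esub> x \<in> \<eta> ` carrier (tensor M B N)"
      using i x MN.tensor_rsmult_closed by (auto simp flip: eta_rsmult)
  qed
qed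

lemma rho_image_ideal: "ideal (\<rho> ` carrier (bitensor N A M)) B"
  by (rule morita_context.eta_image_ideal[OF sym_context])

lemma morita_balanced:
  assumes W: "left_module B W"
  shows "balanced_map A B M W (hom_module B N W)
    (\<lambda>m w. \<lambda>n\<in>carrier N. \<rho> (pure_tensor N A M n m) \<odot>\<^bsub>W\<^esub> w)"
proof -
  interpret W: left_module B W by (rule W)
  interpret H: left_module A "hom_module B N W"
    by (rule hom_module_left_module[OF N.bimodule_axioms W])
  have r: "\<rho> (pure_tensor N A M n m) \<in> carrier B" if "n \<in> carrier N" "m \<in> carrier M" for n m
    using that by (simp add: rho_closed NM.pure_tensor_closed)
  show ?thesis
  proof unfold_locales
    fix m w assume "m \<in> carrier M" "w \<in> carrier W"
    then show "(\<lambda>n\<in>carrier N. \<rho> (pure_tensor N A M n m) \<odot>\<^bsub>W\<^esub> w) \<in> carrier (hom_module B N W)"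
      by (intro hom_module_closedI N.left_module_axioms)
        (simp_all add: r NM.pure_tensor_add_left NM.pure_tensor_closed rho_add W.smult_l_distr
          W.smult_assoc rho_smult flip: NM.tensor_smult_pure)
  next
    fix m m' w assume "m \<in> carrier M" "m' \<in> carrier M" "w \<in> carrier W"
    then show "(\<lambda>n\<in>carrier N. \<rho> (pure_tensor N A M n (m \<oplus>\<^bsub>M\<^esub> m')) \<odot>\<^bsub>W\<^esub> w) =
      (\<lambda>n\<in>carrier N. \<rho> (pure_tensor N A M n m) \<odot>\<^bsub>W\<^esub> w) \<oplus>\<^bsub>hom_module B N W\<^esub>
      (\<lambda>n\<in>carrier N. \<rho> (pure_tensor N A M n m') \<odot>\<^bsub>W\<^esub> w)"
      by (auto simp: hom_module_def fun_eq_iff r NM.pure_tensor_add_right NM.pure_tensor_closed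
          rho_add W.smult_l_distr)
  next
    fix m w w' assume "m \<in> carrier M" "w \<in> carrier W" "w' \<in> carrier W"
    then show "(\<lambda>n\<in>carrier N. \<rho> (pure_tensor N A M n m) \<odot>\<^bsub>W\<^esub> (w \<oplus>\<^bsub>W\<^esub> w')) =
      (\<lambda>n\<in>carrier N. \<rho> (pure_tensor N A M n m) \<odot>\<^bsub>W\<^esub> w) \<oplus>\<^bsub>hom_module B N W\<^esub>
      (\<lambda>n\<in>carrier N. \<rho> (pure_tensor N A M n m) \<odot>\<^bsub>W\<^esub> w')"
      by (auto simp: hom_module_def fun_eq_iff r W.smult_r_distr)
  next
    fix m b w assume "m \<in> carrier M" "b \<in> carrier B" "w \<in> carrier W"
    then show "(\<lambda>n\<in>carrier N. \<rho> (pure_tensor N A M n (m \<star>\<^bsub>M\<^esub> b)) \<odot>\<^bsub>W\<^esub> w) =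
      (\<lambda>n\<in>carrier N. \<rho> (pure_tensor N A M n m) \<odot>\<^bsub>W\<^esub> (b \<odot>\<^bsub>W\<^esub> w))"
      by (auto simp: fun_eq_iff r NM.pure_tensor_closed rho_rsmult W.smult_assoc
          simp flip: NM.tensor_rsmult_pure)
  qed
qed

lemma morita_map_pure:
  assumes "left_module B W" and "m \<in> carrier M" and "w \<in> carrier W"
  shows "morita_map A B M N \<rho> W (pure_tensor M B W m w) =
    (\<lambda>n\<in>carrier N. \<rho> (pure_tensor N A M n m) \<odot>\<^bsub>W\<^esub> w)"
  unfolding morita_map_def
  by (rule balanced_map.tensor_lift_pure[OF morita_balanced[OF assms(1)] assms(2,3)])

lemma morita_map_hom:
  assumes W: "left_module B W"
  shows "morita_map A B M N \<rho> W \<in> left_module_hom A (tensor M B W) (hom_module B N W)"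
proof -
  interpret W: left_module B W by (rule W)
  interpret H: left_module A "hom_module B N W"
    by (rule hom_module_left_module[OF N.bimodule_axioms W])
  interpret T: tensor_pair A B M W by unfold_locales
  interpret TM: left_module A "tensor M B W" by (rule T.tensor_left_module)
  have h: "morita_map A B M N \<rho> W \<in> hom (add_monoid (tensor M B W)) (add_monoid (hom_module B N W))"
    unfolding morita_map_def by (rule balanced_map.tensor_lift_hom[OF morita_balanced[OF W]])
  have cl: "morita_map A B M N \<rho> W \<tau> \<in> carrier (hom_module B N W)"
    if "\<tau> \<in> carrier (tensor M B W)" for \<tau>
    using h that by (auto simp: hom_def)
  have add: "morita_map A B M N \<rho> W (\<sigma> \<oplus>\<^bsub>tensor M B W\<^esub> \<tau>) =
      morita_map A B M N \<rho> W \<sigma> \<oplus>\<^bsub>hom_module B N W\<^esub> morita_map A B M N \<rho> W \<tau>"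
    if "\<sigma> \<in> carrier (tensor M B W)" "\<tau> \<in> carrier (tensor M B W)" for \<sigma> \<tau>
    using h that by (auto simp: hom_def)
  show ?thesis
  proof (rule left_module_homI)
    fix a \<tau> assume a: "a \<in> carrier A" and t: "\<tau> \<in> carrier (tensor M B W)"
    show "morita_map A B M N \<rho> W (a \<odot>\<^bsub>tensor M B W\<^esub> \<tau>) =
      a \<odot>\<^bsub>hom_module B N W\<^esub> morita_map A B M N \<rho> W \<tau>"
    proof (rule T.tensor_hom_eqI[OF H.V.abelian_group_axioms _ _ _ t,
          where f = "\<lambda>\<tau>. morita_map A B M N \<rho> W (a \<odot>\<^bsub>tensor M B W\<^esub> \<tau>)"])
      fix m w assume m: "m \<in> carrier M" and w: "w \<in> carrier W"
      then show "morita_map A B M N \<rho> W (a \<odot>\<^bsub>tensor M B W\<^esub> pure_tensor M B W m w) =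
        a \<odot>\<^bsub>hom_module B N W\<^esub> morita_map A B M N \<rho> W (pure_tensor M B W m w)"
        using a by (simp add: T.tensor_smult_pure morita_map_pure[OF W])
          (auto simp: hom_module_def fun_eq_iff NM.pure_tensor_balanced)
    qed (use a in \<open>auto intro!: homI simp: cl add TM.smult_r_distr H.smult_r_distr\<close>)
  qed (simp_all add: cl add)
qed

lemma morita_D_left_module:
  assumes W: "left_module B W"
  shows "left_module A (morita_D A B M N \<rho> W)"
proof -
  interpret W: left_module B W by (rule W)
  interpret H: left_module A "hom_module B N W"
    by (rule hom_module_left_module[OF N.bimodule_axioms W])
  interpret T: tensor_pair A B M W by unfold_locales
  interpret TM: left_module A "tensor M B W" by (rule T.tensor_left_module)
  let ?f = "morita_map A B M N \<rho> W" and ?T = "tensor M B W" and ?D = "morita_D A B M N \<rho> W"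
  note f = left_module_homD[OF morita_map_hom[OF W]]
  have D: "carrier ?D = ?f ` carrier ?T" "\<zero>\<^bsub>?D\<^esub> = \<zero>\<^bsub>hom_module B N W\<^esub>"
    "x \<oplus>\<^bsub>?D\<^esub> y = x \<oplus>\<^bsub>hom_module B N W\<^esub> y" "a \<odot>\<^bsub>?D\<^esub> x = a \<odot>\<^bsub>hom_module B N W\<^esub> x" for x y a
    by (simp_all add: morita_D_def)
  have z: "?f \<zero>\<^bsub>?T\<^esub> = \<zero>\<^bsub>hom_module B N W\<^esub>"
    using f(2)[of "\<zero>\<^bsub>?T\<^esub>" "\<zero>\<^bsub>?T\<^esub>"] f(1)[of "\<zero>\<^bsub>?T\<^esub>"] by (simp add: H.V.add.l_cancel_one)
  have "abelian_group ?D"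
  proof (rule abelian_groupI)
    fix x assume "x \<in> carrier ?D"
    then obtain t where t: "t \<in> carrier ?T" "x = ?f t" by (auto simp: D)
    then show "\<exists>y\<in>carrier ?D. y \<oplus>\<^bsub>?D\<^esub> x = \<zero>\<^bsub>?D\<^esub>"
      by (intro bexI[of _ "?f (\<ominus>\<^bsub>?T\<^esub> t)"]) (auto simp: D z TM.V.l_neg simp flip: f(2))
  next
    fix x y assume "x \<in> carrier ?D" "y \<in> carrier ?D"
    then show "x \<oplus>\<^bsub>?D\<^esub> y \<in> carrier ?D"
      by (auto simp: D simp flip: f(2))
  next
    show "\<zero>\<^bsub>?D\<^esub> \<in> carrier ?D"
      unfolding D z[symmetric] by simp
  qed (auto simp: D f(1) H.V.a_ac)
  then show ?thesis
    by (intro left_moduleI M.A.ring_axioms)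
      (auto simp: D f(1) f(2) TM.smult_l_distr H.smult_r_distr TM.smult_assoc simp flip: f(3))
qed

end

end

theory Submission
  imports Defs
begin

text \<open>For \<open>f\<close> in \<open>Hom\<^sub>B(N, W)\<close> one has \<open>\<eta>(m \<otimes> n) f = (n' \<mapsto> \<rho>(n' \<otimes> m) f(n))\<close>.  If \<open>W\<close> is simple and
  \<open>f(n) \<noteq> 0\<close>, then \<open>f(n)\<close> generates \<open>W\<close>, so every nonzero submodule of \<open>Hom\<^sub>B(N, W)\<close> contains
  \<open>DW\<close>; hence \<open>DW\<close> is simple as soon as it is nonzero.  By Schur's argument, a nonzero balanced pairing
  \<open>N \<times> V \<rightarrow> W\<close> with \<open>V\<close> simple embeds \<open>V\<close> into \<open>Hom\<^sub>B(N, W)\<close> with image \<open>DW\<close>.  This criterion shows that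
  \<open>D\<close> respects isomorphism, and, applied in the opposite context to the pairing
  \<open>M \<times> W \<rightarrow> DW\<close>, that the construction in the other direction is inverse to \<open>D\<close>.\<close>

section \<open>Submodules under homomorphisms\<close>

text \<open>Closure under negation follows from closure under scalars, because \<open>-u\<close> is
  \<open>(-1) u\<close>.\<close>

lemma (in left_module) submoduleI_smult:
  assumes "U \<subseteq> carrier V" and "\<zero> \<in> U"
    and "\<And>u v. \<lbrakk>u \<in> U; v \<in> U\<rbrakk> \<Longrightarrow> u \<oplus> v \<in> U"
    and "\<And>a u. \<lbrakk>a \<in> carrier A; u \<in> U\<rbrakk> \<Longrightarrow> a \<odot> u \<in> U"
  shows "submodule U A V"
proof -
  have "\<ominus> u \<in> U" if "u \<in> U" for u
  proof -
    have u: "u \<in> carrier V" using assms(1) that by blast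
    have "(\<ominus>\<^bsub>A\<^esub> \<one>\<^bsub>A\<^esub>) \<odot> u \<oplus> u = (\<ominus>\<^bsub>A\<^esub> \<one>\<^bsub>A\<^esub> \<oplus>\<^bsub>A\<^esub> \<one>\<^bsub>A\<^esub>) \<odot> u"
      using u by (simp add: smult_l_distr)
    also have "\<dots> = \<zero>" using u by (simp add: A.l_neg smult_zero_left)
    finally have "\<ominus> u = (\<ominus>\<^bsub>A\<^esub> \<one>\<^bsub>A\<^esub>) \<odot> u"
      using u by (simp add: V.minus_equality)
    then show ?thesis using assms(4) that by simp
  qed
  then show ?thesis
    using assms by (intro submodule.intro subgroup.intro submodule_axioms.intro)
      (auto simp flip: a_inv_def)
qed

lemma submoduleD:
  assumes "submodule U A V"
  shows "U \<subseteq> carrier V" and "\<zero>\<^bsub>V\<^esub> \<in> U"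
    and "\<And>u v. \<lbrakk>u \<in> U; v \<in> U\<rbrakk> \<Longrightarrow> u \<oplus>\<^bsub>V\<^esub> v \<in> U"
    and "\<And>a u. \<lbrakk>a \<in> carrier A; u \<in> U\<rbrakk> \<Longrightarrow> a \<odot>\<^bsub>V\<^esub> u \<in> U"
    and "\<And>u. u \<in> U \<Longrightarrow> \<ominus>\<^bsub>V\<^esub> u \<in> U"
proof -
  interpret submodule U A V by (rule assms)
  show "U \<subseteq> carrier V" "\<zero>\<^bsub>V\<^esub> \<in> U" "\<And>u v. \<lbrakk>u \<in> U; v \<in> U\<rbrakk> \<Longrightarrow> u \<oplus>\<^bsub>V\<^esub> v \<in> U"
    "\<And>a u. \<lbrakk>a \<in> carrier A; u \<in> U\<rbrakk> \<Longrightarrow> a \<odot>\<^bsub>V\<^esub> u \<in> U" "\<And>u. u \<in> U \<Longrightarrow> \<ominus>\<^bsub>V\<^esub> u \<in> U"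
    using subset one_closed m_closed smult_closed m_inv_closed by (auto simp: a_inv_def)
qed

lemma left_module_hom_zero:
  assumes "left_module A V" and "left_module A W" and "f \<in> left_module_hom A V W"
  shows "f \<zero>\<^bsub>V\<^esub> = \<zero>\<^bsub>W\<^esub>"
proof -
  interpret V: left_module A V by (rule assms)
  interpret W: left_module A W by (rule assms)
  note f = left_module_homD[OF assms(3)]
  show ?thesis
    using f(2)[of "\<zero>\<^bsub>V\<^esub>" "\<zero>\<^bsub>V\<^esub>"] f(1)[of "\<zero>\<^bsub>V\<^esub>"] by (simp add: W.add.l_cancel_one)
qed

lemma submodule_vimage:
  assumes V: "left_module A V" and W: "left_module A W" and f: "f \<in> left_module_hom A V W"
    and U: "submodule U A W"
  shows "submodule {v \<in> carrier V. f v \<in> U} A V"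
proof -
  interpret V: left_module A V by (rule V)
  note U = submoduleD[OF U]
  show ?thesis
    by (rule V.submoduleI_smult)
      (auto simp: left_module_homD[OF f] left_module_hom_zero[OF V W f] U)
qed

lemma submodule_image:
  assumes V: "left_module A V" and W: "left_module A W" and f: "f \<in> left_module_hom A V W"
  shows "submodule (f ` carrier V) A W"
proof -
  interpret V: left_module A V by (rule V)
  interpret W: left_module A W by (rule W)
  show ?thesis
  proof (rule W.submoduleI_smult)
    show "\<zero>\<^bsub>W\<^esub> \<in> f ` carrier V"
      by (metis V.zero_closed imageI left_module_hom_zero[OF V W f])
  qed (auto simp: left_module_homD(1)[OF f] simp flip: left_module_homD(2,3)[OF f])
qed

lemma (in left_module) submodule_zero: "submodule {\<zero>} A V"
  by (rule submoduleI_smult) (auto simp: smult_zero_right)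

section \<open>Simple modules and Schur's argument\<close>

lemma simple_left_moduleD:
  assumes "simple_left_module A V"
  shows "left_module A V" and "\<exists>v \<in> carrier V. v \<noteq> \<zero>\<^bsub>V\<^esub>"
    and "\<And>U v. \<lbrakk>submodule U A V; v \<in> U; v \<noteq> \<zero>\<^bsub>V\<^esub>\<rbrakk> \<Longrightarrow> U = carrier V"
proof -
  show V: "left_module A V" using assms by (simp add: simple_left_module_def)
  interpret V: left_module A V by (rule V)
  show "\<exists>v \<in> carrier V. v \<noteq> \<zero>\<^bsub>V\<^esub>"
    using assms V.zero_closed unfolding simple_left_module_def by blast
  show "\<And>U v. \<lbrakk>submodule U A V; v \<in> U; v \<noteq> \<zero>\<^bsub>V\<^esub>\<rbrakk> \<Longrightarrow> U = carrier V"
    using assms unfolding simple_left_module_def by blast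
qed

lemma simple_left_moduleI:
  assumes "left_module A V" and "v \<in> carrier V" and "v \<noteq> \<zero>\<^bsub>V\<^esub>"
    and "\<And>U u. \<lbrakk>submodule U A V; u \<in> U; u \<noteq> \<zero>\<^bsub>V\<^esub>\<rbrakk> \<Longrightarrow> carrier V \<subseteq> U"
  shows "simple_left_module A V"
  unfolding simple_left_module_def
proof (intro conjI allI impI)
  show "left_module A V" "carrier V \<noteq> {\<zero>\<^bsub>V\<^esub>}" using assms(1-3) by auto
  fix U assume U: "submodule U A V"
  show "U = {\<zero>\<^bsub>V\<^esub>} \<or> U = carrier V"
    using assms(4)[OF U] submoduleD(1,2)[OF U] by blast
qed

lemma simple_left_module_cyclic:
  assumes V: "simple_left_module A V" and "v \<in> carrier V" and "v \<noteq> \<zero>\<^bsub>V\<^esub>" and "w \<in> carrier V"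
  obtains a where "a \<in> carrier A" and "w = a \<odot>\<^bsub>V\<^esub> v"
proof -
  interpret V: left_module A V by (rule simple_left_moduleD(1)[OF V])
  have "v \<in> (\<lambda>a. a \<odot>\<^bsub>V\<^esub> v) ` carrier A"
    using assms(2) by (intro image_eqI[of _ _ "\<one>\<^bsub>A\<^esub>"]) auto
  then have "(\<lambda>a. a \<odot>\<^bsub>V\<^esub> v) ` carrier A = carrier V"
    using simple_left_moduleD(3)[OF V V.submodule_cyclic] assms(2,3) by blast
  with assms(4) that show thesis by blast
qed

text \<open>The kernel is the preimage of the zero submodule. A nonzero element in it would make it
  all of \<open>V\<close>, against \<open>f v\<close> being nonzero.\<close>

lemma simple_left_module_hom_inj:
  assumes V: "simple_left_module A V" and W: "left_module A W" and f: "f \<in> left_module_hom A V W"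
    and v: "v \<in> carrier V" "f v \<noteq> \<zero>\<^bsub>W\<^esub>"
  shows "inj_on f (carrier V)"
proof -
  note V' = simple_left_moduleD(1)[OF V]
  interpret V: left_module A V by (rule V')
  interpret W: left_module A W by (rule W)
  have ker: "x = \<zero>\<^bsub>V\<^esub>" if "x \<in> carrier V" "f x = \<zero>\<^bsub>W\<^esub>" for x
    using simple_left_moduleD(3)[OF V submodule_vimage[OF V' W f W.submodule_zero], of x] that v
    by blast
  show ?thesis
  proof (rule inj_onI)
    fix x y assume xy: "x \<in> carrier V" "y \<in> carrier V" "f x = f y"
    have "f (x \<oplus>\<^bsub>V\<^esub> \<ominus>\<^bsub>V\<^esub> y) = f (y \<oplus>\<^bsub>V\<^esub> \<ominus>\<^bsub>V\<^esub> y)"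
      using xy by (simp add: left_module_homD[OF f] del: V.r_neg)
    also have "\<dots> = \<zero>\<^bsub>W\<^esub>"
      using xy by (simp add: V.r_neg left_module_hom_zero[OF V' W f])
    finally have "x \<oplus>\<^bsub>V\<^esub> \<ominus>\<^bsub>V\<^esub> y = \<zero>\<^bsub>V\<^esub>"
      using xy by (intro ker) simp_all
    then have "\<ominus>\<^bsub>V\<^esub> (\<ominus>\<^bsub>V\<^esub> y) = x"
      using xy by (intro V.V.minus_equality) simp_all
    then show "x = y" using xy(2) by simp
  qed
qed

text \<open>A nonzero submodule of \<open>W\<close> pulls back along \<open>f\<close> to a nonzero
  submodule of \<open>V\<close>, hence to all of \<open>V\<close>; surjectivity of \<open>f\<close>
  then makes it all of \<open>W\<close>.\<close>

lemma simple_left_module_isomorphic: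
  assumes V: "simple_left_module A V" and W: "left_module A W" and iso: "left_module_isomorphic A V W"
  shows "simple_left_module A W"
proof -
  note V' = simple_left_moduleD(1)[OF V]
  obtain f where f: "f \<in> left_module_hom A V W" and b: "bij_betw f (carrier V) (carrier W)"
    using iso by (auto simp: left_module_isomorphic_def)
  interpret V: left_module A V by (rule V')
  obtain v where v: "v \<in> carrier V" "v \<noteq> \<zero>\<^bsub>V\<^esub>" using simple_left_moduleD(2)[OF V] by blast
  have z: "f \<zero>\<^bsub>V\<^esub> = \<zero>\<^bsub>W\<^esub>" by (rule left_module_hom_zero[OF V' W f])
  show ?thesis
  proof (rule simple_left_moduleI[OF W, of "f v"])
    show "f v \<in> carrier W" by (rule left_module_homD(1)[OF f v(1)])
    show "f v \<noteq> \<zero>\<^bsub>W\<^esub>" using b v z by (metis V.zero_closed bij_betw_def inj_onD)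
  next
    fix U u assume U: "submodule U A W" and u: "u \<in> U" "u \<noteq> \<zero>\<^bsub>W\<^esub>"
    obtain x where x: "x \<in> carrier V" "u = f x"
      using u(1) submoduleD(1)[OF U] b by (auto simp: bij_betw_def)
    then have "x \<noteq> \<zero>\<^bsub>V\<^esub>" using u z by auto
    then have "{v \<in> carrier V. f v \<in> U} = carrier V"
      using simple_left_moduleD(3)[OF V submodule_vimage[OF V' W f U], of x] x u by blast
    then have "f ` carrier V \<subseteq> U" by blast
    then show "carrier W \<subseteq> U" using b by (simp add: bij_betw_def)
  qed
qed

section \<open>Ideals acting on simple modules, and isomorphism classes\<close>

text \<open>If \<open>i v\<close> is nonzero, then \<open>I v\<close> for this fixed
  \<open>v\<close> is a nonzero submodule, since \<open>I\<close> is a left ideal; so it is all of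
  \<open>V\<close>, and single products already exhaust \<open>V\<close>. If all products vanish,
  they generate only zero.\<close>

lemma ideal_smult_simple_iff:
  assumes I: "ideal I A" and V: "simple_left_module A V"
  shows "ideal_smult I V = carrier V \<longleftrightarrow> (\<exists>i\<in>I. \<exists>v\<in>carrier V. i \<odot>\<^bsub>V\<^esub> v \<noteq> \<zero>\<^bsub>V\<^esub>)"
proof -
  interpret I: ideal I A by (rule I)
  note V' = simple_left_moduleD(1)[OF V]
  interpret V: left_module A V by (rule V')
  let ?S = "{i \<odot>\<^bsub>V\<^esub> v | i v. i \<in> I \<and> v \<in> carrier V}"
  have IA: "i \<in> carrier A" if "i \<in> I" for i using that by (rule I.Icarr)
  have S: "?S \<subseteq> carrier V" using IA by blast
  show ?thesis
  proof
    assume eq: "ideal_smult I V = carrier V"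
    show "\<exists>i\<in>I. \<exists>v\<in>carrier V. i \<odot>\<^bsub>V\<^esub> v \<noteq> \<zero>\<^bsub>V\<^esub>"
    proof (rule ccontr)
      assume "\<not> ?thesis"
      then have "?S \<subseteq> {\<zero>\<^bsub>V\<^esub>}" by blast
      then have "generate (add_monoid V) ?S \<subseteq> {\<zero>\<^bsub>V\<^esub>}"
        using group.generate_subgroup_incl[OF V.a_group]
          submodule.axioms(1)[OF V.submodule_zero] by blast
      then show False
        using eq simple_left_moduleD(2)[OF V] unfolding ideal_smult_def by blast
    qed
  next
    assume "\<exists>i\<in>I. \<exists>v\<in>carrier V. i \<odot>\<^bsub>V\<^esub> v \<noteq> \<zero>\<^bsub>V\<^esub>"
    then obtain i v where iv: "i \<in> I" "v \<in> carrier V" "i \<odot>\<^bsub>V\<^esub> v \<noteq> \<zero>\<^bsub>V\<^esub>" by blast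
    have "submodule ((\<lambda>j. j \<odot>\<^bsub>V\<^esub> v) ` I) A V"
    proof (rule V.submoduleI_smult)
      show "\<zero>\<^bsub>V\<^esub> \<in> (\<lambda>j. j \<odot>\<^bsub>V\<^esub> v) ` I"
        using iv(2) by (intro image_eqI[of _ _ "\<zero>\<^bsub>A\<^esub>"]) (simp_all add: V.smult_zero_left I.zero_closed)
    qed (use iv(2) IA I.I_l_closed I.a_closed in
        \<open>auto simp flip: V.smult_l_distr V.smult_assoc intro!: imageI\<close>)
    then have "(\<lambda>j. j \<odot>\<^bsub>V\<^esub> v) ` I = carrier V"
      using simple_left_moduleD(3)[OF V] iv by blast
    then have "carrier V \<subseteq> ?S" using iv(2) by blast
    then have "carrier V \<subseteq> ideal_smult I V"
      unfolding ideal_smult_def by (auto intro: generate.incl)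
    moreover have "ideal_smult I V \<subseteq> carrier V"
      unfolding ideal_smult_def
      using group.generate_incl[OF V.a_group, of ?S] S by simp
    ultimately show "ideal_smult I V = carrier V" by blast
  qed
qed

text \<open>By the preceding criterion one nonzero product suffices, and \<open>f\<close> carries
  \<open>i v\<close> to the nonzero product \<open>i (f v)\<close>.\<close>

lemma ideal_smult_isomorphic:
  assumes I: "ideal I A" and V: "simple_left_module A V" and W: "left_module A W"
    and iso: "left_module_isomorphic A V W" and eq: "ideal_smult I V = carrier V"
  shows "ideal_smult I W = carrier W"
proof -
  note V' = simple_left_moduleD(1)[OF V]
  interpret V: left_module A V by (rule V')
  interpret I: ideal I A by (rule I)
  obtain f where f: "f \<in> left_module_hom A V W" and b: "bij_betw f (carrier V) (carrier W)"
    using iso by (auto simp: left_module_isomorphic_def)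
  obtain i v where iv: "i \<in> I" "v \<in> carrier V" "i \<odot>\<^bsub>V\<^esub> v \<noteq> \<zero>\<^bsub>V\<^esub>"
    using eq ideal_smult_simple_iff[OF I V] by blast
  have iA: "i \<in> carrier A" using iv(1) by (rule I.Icarr)
  have "f (i \<odot>\<^bsub>V\<^esub> v) \<noteq> f \<zero>\<^bsub>V\<^esub>"
    using b iv iA by (metis V.smult_closed V.zero_closed bij_betw_def inj_onD)
  then have "i \<odot>\<^bsub>W\<^esub> f v \<noteq> \<zero>\<^bsub>W\<^esub>"
    using iv iA by (simp add: left_module_homD(3)[OF f] left_module_hom_zero[OF V' W f])
  then show ?thesis
    using ideal_smult_simple_iff[OF I simple_left_module_isomorphic[OF V W iso]]
      iv left_module_homD(1)[OF f] by blast
qed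

text \<open>Lets an arbitrarily chosen member of a class stand in for \<open>V\<close>.\<close>

lemma iso_class_simple:
  assumes I: "ideal I A" and V: "simple_left_module A V" "ideal_smult I V = carrier V"
    and W: "W \<in> iso_class A V"
  shows "simple_left_module A W" and "ideal_smult I W = carrier W"
    and "left_module_isomorphic A V W"
  using W simple_left_module_isomorphic[OF V(1)] ideal_smult_isomorphic[OF I V(1) _ _ V(2)]
  by (auto simp: iso_class_def)

text \<open>Here \<open>V\<close> may live on any type.\<close>

lemma iso_class_in_Irr_ideal:
  assumes I: "ideal I A" and V: "simple_left_module A V" "ideal_smult I V = carrier V"
  shows "iso_class A V \<in> Irr_ideal A I"
proof -
  obtain W where W: "W \<in> iso_class A V" using iso_class_nonempty[OF V(1)] by blast
  note s = iso_class_simple[OF I V W]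
  have "iso_class A V = iso_class A W"
    using iso_class_eq_iff[OF V(1) s(1)] s(3) by blast
  then show ?thesis using s(1,2) by (auto simp: Irr_ideal_def)
qed

section \<open>The module \<open>DW\<close> inside \<open>Hom(N, W)\<close>\<close>

context morita_context
begin

abbreviation "DM W \<equiv> morita_D A B M N \<rho> W"
abbreviation "HM W \<equiv> hom_module B N W"
abbreviation "pe m n \<equiv> \<eta> (pure_tensor M B N m n)"
abbreviation "pr n m \<equiv> \<rho> (pure_tensor N A M n m)"
text \<open>This is the image of the pure tensor of \<open>m\<close> and \<open>w\<close> under
  \<open>morita_map\<close>, as \<open>morita_map_pure\<close> states.\<close>

abbreviation "DM_gen W m w \<equiv> \<lambda>n\<in>carrier N. pr n m \<odot>\<^bsub>W\<^esub> w"

lemma pe_closed: "\<lbrakk>m \<in> carrier M; n \<in> carrier N\<rbrakk> \<Longrightarrow> pe m n \<in> carrier A"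
  by (simp add: eta_closed MN.pure_tensor_closed)

lemma pr_closed: "\<lbrakk>n \<in> carrier N; m \<in> carrier M\<rbrakk> \<Longrightarrow> pr n m \<in> carrier B"
  by (simp add: rho_closed NM.pure_tensor_closed)

lemma morita_D_simps:
  "carrier (DM W) = morita_map A B M N \<rho> W ` carrier (tensor M B W)"
  "\<zero>\<^bsub>DM W\<^esub> = \<zero>\<^bsub>HM W\<^esub>" "x \<oplus>\<^bsub>DM W\<^esub> y = x \<oplus>\<^bsub>HM W\<^esub> y" "a \<odot>\<^bsub>DM W\<^esub> x = a \<odot>\<^bsub>HM W\<^esub> x"
  by (simp_all add: morita_D_def)

lemma morita_D_submodule:
  assumes W: "left_module B W"
  shows "submodule (carrier (DM W)) A (HM W)"
proof -
  interpret W: left_module B W by (rule W)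
  interpret T: tensor_pair A B M W by unfold_locales
  show ?thesis
    unfolding morita_D_simps(1)
    by (rule submodule_image[OF T.tensor_left_module
          hom_module_left_module[OF N.bimodule_axioms W] morita_map_hom[OF W]])
qed

lemma morita_D_gen:
  assumes W: "left_module B W" and "m \<in> carrier M" and "w \<in> carrier W"
  shows "DM_gen W m w \<in> carrier (DM W)"
proof -
  interpret W: left_module B W by (rule W)
  interpret T: tensor_pair A B M W by unfold_locales
  show ?thesis
    using assms T.pure_tensor_closed unfolding morita_D_simps
    by (auto simp flip: morita_map_pure[OF W])
qed

text \<open>The preimage of \<open>U\<close> under \<open>morita_map\<close> is a submodule of the
  tensor product that contains every pure tensor, so it is everything. Together with
  \<open>morita_D_gen\<close> this says that \<open>DW\<close> is the submodule generated by the
  elements \<open>DM_gen W m w\<close>.\<close>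

lemma morita_D_least:
  assumes W: "left_module B W" and U: "submodule U A (HM W)"
    and gen: "\<And>m w. \<lbrakk>m \<in> carrier M; w \<in> carrier W\<rbrakk> \<Longrightarrow> DM_gen W m w \<in> U"
  shows "carrier (DM W) \<subseteq> U"
proof -
  interpret W: left_module B W by (rule W)
  interpret T: tensor_pair A B M W by unfold_locales
  interpret TM: left_module A "tensor M B W" by (rule T.tensor_left_module)
  let ?P = "{\<tau> \<in> carrier (tensor M B W). morita_map A B M N \<rho> W \<tau> \<in> U}"
  note P = submoduleD[OF submodule_vimage[OF T.tensor_left_module
        hom_module_left_module[OF N.bimodule_axioms W] morita_map_hom[OF W] U]]
  have "\<tau> \<in> ?P" if "\<tau> \<in> carrier (tensor M B W)" for \<tau>
    using that
  proof (induction rule: T.tensor_induct)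
    case zero
    show ?case by (rule P(2))
  next
    case (diff \<sigma> \<tau>)
    show ?case unfolding TM.V.minus_eq by (intro P(3) P(5) diff)
  next
    case (pure x w)
    then show ?case by (simp add: T.pure_tensor_closed morita_map_pure[OF W] gen)
  qed
  then show ?thesis by (auto simp: morita_D_simps)
qed

lemma hom_moduleD:
  assumes "f \<in> carrier (HM W)"
  shows "f \<in> left_module_hom B N W" and "f \<in> extensional (carrier N)"
  using assms by (simp_all add: hom_module_def)

text \<open>Elements of \<open>HM W\<close> are extensional, so \<open>f\<close> and the zero map
  can only differ at a point of \<open>N\<close>.\<close>

lemma hom_module_nonzero:
  assumes "f \<in> carrier (HM W)" and "f \<noteq> \<zero>\<^bsub>HM W\<^esub>"
  obtains n where "n \<in> carrier N" and "f n \<noteq> \<zero>\<^bsub>W\<^esub>"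
proof -
  have "\<exists>n\<in>carrier N. f n \<noteq> \<zero>\<^bsub>W\<^esub>"
  proof (rule ccontr)
    assume "\<not> ?thesis"
    then have "f = \<zero>\<^bsub>HM W\<^esub>"
      using hom_moduleD(2)[OF assms(1)] by (auto simp: hom_module_def extensional_def fun_eq_iff)
    with assms(2) show False by simp
  qed
  with that show thesis by blast
qed

text \<open>The action evaluates \<open>f\<close> at \<open>n' \<eta>(m \<otimes> n)\<close>, which
  the Morita identity \<open>rho_eta\<close> turns into \<open>\<rho>(n' \<otimes> m) n\<close>; the
  scalar then leaves \<open>f\<close> by \<open>B\<close>-linearity. In particular
  \<open>pe m n\<close> sends all of \<open>HM W\<close> into \<open>DW\<close>.\<close>

lemma eta_smult_hom_module:
  assumes W: "left_module B W" and f: "f \<in> carrier (HM W)"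
    and m: "m \<in> carrier M" and n: "n \<in> carrier N"
  shows "pe m n \<odot>\<^bsub>HM W\<^esub> f = DM_gen W m (f n)"
proof -
  have "f (n' \<star>\<^bsub>N\<^esub> pe m n) = pr n' m \<odot>\<^bsub>W\<^esub> f n" if "n' \<in> carrier N" for n'
  proof -
    have "f (n' \<star>\<^bsub>N\<^esub> pe m n) = f (pr n' m \<odot>\<^bsub>N\<^esub> n)"
      using rho_eta[OF that m n] by simp
    then show ?thesis
      using left_module_homD(3)[OF hom_moduleD(1)[OF f]] pr_closed that m n by simp
  qed
  then show ?thesis by (auto simp: hom_module_def fun_eq_iff)
qed

lemma DM_gen_balanced:
  assumes W: "left_module B W" and "m \<in> carrier M" and "b \<in> carrier B" and "w \<in> carrier W"
  shows "DM_gen W m (b \<odot>\<^bsub>W\<^esub> w) = DM_gen W (m \<star>\<^bsub>M\<^esub> b) w"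
  using balanced_map.phi_balanced[OF morita_balanced[OF W] assms(2-4)] by simp

text \<open>This is where simplicity of \<open>W\<close> enters: \<open>f n\<close> generates \<open>W\<close>.\<close>

lemma DM_gen_eq_smult:
  assumes W: "simple_left_module B W" and f: "f \<in> carrier (HM W)"
    and n: "n \<in> carrier N" "f n \<noteq> \<zero>\<^bsub>W\<^esub>" and m: "m \<in> carrier M" and w: "w \<in> carrier W"
  obtains m' where "m' \<in> carrier M" and "DM_gen W m w = pe m' n \<odot>\<^bsub>HM W\<^esub> f"
proof -
  note W' = simple_left_moduleD(1)[OF W]
  have fn: "f n \<in> carrier W" by (rule left_module_homD(1)[OF hom_moduleD(1)[OF f] n(1)])
  obtain b where b: "b \<in> carrier B" "w = b \<odot>\<^bsub>W\<^esub> f n"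
    by (rule simple_left_module_cyclic[OF W fn n(2) w])
  \<comment> \<open>The witness is \<open>m b\<close>: balancing moves \<open>b\<close> from
    \<open>f n\<close> over to \<open>m\<close>, where \<open>eta_smult_hom_module\<close>
    applies.\<close>
  have mb: "m \<star>\<^bsub>M\<^esub> b \<in> carrier M" using m b by simp
  show thesis
    using that[OF mb] DM_gen_balanced[OF W' m b(1) fn] eta_smult_hom_module[OF W' f mb n(1)] b(2)
    by simp
qed

text \<open>Every generator of \<open>DW\<close> is a multiple \<open>pe m' n\<close> of
  \<open>f\<close> by the preceding lemma, so it lies in each submodule containing
  \<open>f\<close>.\<close>

lemma morita_D_subset_submodule:
  assumes W: "simple_left_module B W" and U: "submodule U A (HM W)"
    and f: "f \<in> U" "f \<noteq> \<zero>\<^bsub>HM W\<^esub>"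
  shows "carrier (DM W) \<subseteq> U"
proof -
  note W' = simple_left_moduleD(1)[OF W]
  have fH: "f \<in> carrier (HM W)" using submoduleD(1)[OF U] f(1) by blast
  obtain n where n: "n \<in> carrier N" "f n \<noteq> \<zero>\<^bsub>W\<^esub>" by (rule hom_module_nonzero[OF fH f(2)])
  show ?thesis
  proof (rule morita_D_least[OF W' U])
    fix m w assume "m \<in> carrier M" "w \<in> carrier W"
    then obtain m' where "m' \<in> carrier M" "DM_gen W m w = pe m' n \<odot>\<^bsub>HM W\<^esub> f"
      by (rule DM_gen_eq_smult[OF W fH n])
    then show "DM_gen W m w \<in> U"
      using submoduleD(4)[OF U] pe_closed n(1) f(1) by simp
  qed
qed

section \<open>Nonvanishing and simplicity of \<open>DW\<close>\<close>

text \<open>If every \<open>pe m n\<close> killed \<open>v\<close>, the additive maps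
  \<open>\<tau> \<mapsto> \<eta>(\<tau>) v\<close> and zero would agree on pure tensors and hence
  everywhere.\<close>

lemma eta_image_pure_nonzero:
  assumes V: "left_module A V" and i: "i \<in> \<eta> ` carrier (bitensor M B N)"
    and v: "v \<in> carrier V" "i \<odot>\<^bsub>V\<^esub> v \<noteq> \<zero>\<^bsub>V\<^esub>"
  shows "\<exists>m\<in>carrier M. \<exists>n\<in>carrier N. pe m n \<odot>\<^bsub>V\<^esub> v \<noteq> \<zero>\<^bsub>V\<^esub>"
proof (rule ccontr)
  interpret V: left_module A V by (rule V)
  assume contr: "\<not> ?thesis"
  obtain \<tau> where t: "\<tau> \<in> carrier (tensor M B N)" "i = \<eta> \<tau>" using i by auto
  have "\<eta> \<tau> \<odot>\<^bsub>V\<^esub> v = \<zero>\<^bsub>V\<^esub>"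
    by (rule MN.tensor_hom_eqI[OF V.V.abelian_group_axioms _ _ _ t(1),
          where f = "\<lambda>\<tau>. \<eta> \<tau> \<odot>\<^bsub>V\<^esub> v" and g = "\<lambda>_. \<zero>\<^bsub>V\<^esub>"])
      (use contr v in \<open>auto intro!: homI simp: eta_closed eta_add V.smult_l_distr\<close>)
  with t v show False by simp
qed

text \<open>The preceding lemma in the opposite context, with \<open>\<eta>\<close> and
  \<open>\<rho>\<close> exchanged; the criterion for \<open>JW = W\<close> supplies the nonzero
  product.\<close>

lemma rho_image_pure_nonzero:
  assumes W: "simple_left_module B W"
    and JW: "ideal_smult (\<rho> ` carrier (bitensor N A M)) W = carrier W"
  obtains n m w where "n \<in> carrier N" and "m \<in> carrier M" and "w \<in> carrier W"
    and "pr n m \<odot>\<^bsub>W\<^esub> w \<noteq> \<zero>\<^bsub>W\<^esub>"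
proof -
  obtain i v where "i \<in> \<rho> ` carrier (bitensor N A M)" "v \<in> carrier W" "i \<odot>\<^bsub>W\<^esub> v \<noteq> \<zero>\<^bsub>W\<^esub>"
    using ideal_smult_simple_iff[OF rho_image_ideal W] JW by blast
  with morita_context.eta_image_pure_nonzero[OF sym_context simple_left_moduleD(1)[OF W]] that
  show thesis by blast
qed

lemma DM_gen_nonzero:
  assumes W: "simple_left_module B W"
    and JW: "ideal_smult (\<rho> ` carrier (bitensor N A M)) W = carrier W"
  obtains m w where "m \<in> carrier M" and "w \<in> carrier W" and "DM_gen W m w \<noteq> \<zero>\<^bsub>HM W\<^esub>"
proof -
  obtain n m w where nmw: "n \<in> carrier N" "m \<in> carrier M" "w \<in> carrier W"
    "pr n m \<odot>\<^bsub>W\<^esub> w \<noteq> \<zero>\<^bsub>W\<^esub>"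
    by (rule rho_image_pure_nonzero[OF W JW])
  then have "DM_gen W m w \<noteq> \<zero>\<^bsub>HM W\<^esub>"
    by (auto simp: hom_module_def dest!: fun_cong[of _ _ n])
  with nmw that show thesis by blast
qed

lemma morita_D_simple:
  assumes W: "simple_left_module B W"
    and JW: "ideal_smult (\<rho> ` carrier (bitensor N A M)) W = carrier W"
  shows "simple_left_module A (DM W)"
    and "ideal_smult (\<eta> ` carrier (bitensor M B N)) (DM W) = carrier (DM W)"
proof -
  note W' = simple_left_moduleD(1)[OF W]
  interpret H: left_module A "HM W" by (rule hom_module_left_module[OF N.bimodule_axioms W'])
  note D = morita_D_submodule[OF W']
  obtain m w where mw: "m \<in> carrier M" "w \<in> carrier W" "DM_gen W m w \<noteq> \<zero>\<^bsub>HM W\<^esub>"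
    by (rule DM_gen_nonzero[OF W JW])
  let ?f = "DM_gen W m w"
  have fD: "?f \<in> carrier (DM W)" by (rule morita_D_gen[OF W' mw(1,2)])
  show simple: "simple_left_module A (DM W)"
  proof (rule simple_left_moduleI[OF morita_D_left_module[OF W'] fD])
    fix U u assume U: "submodule U A (DM W)" and u: "u \<in> U" "u \<noteq> \<zero>\<^bsub>DM W\<^esub>"
    \<comment> \<open>\<open>DW\<close> carries the operations of \<open>HM W\<close>, so its
      submodules are submodules there, and a nonzero one contains \<open>DW\<close>.\<close>
    have "submodule U A (HM W)"
      using submoduleD[OF U] submoduleD(1)[OF D]
      by (intro H.submoduleI_smult) (auto simp: morita_D_simps(2-4))
    with u show "carrier (DM W) \<subseteq> U"
      by (intro morita_D_subset_submodule[OF W]) (auto simp: morita_D_simps(2))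
  qed (use mw(3) in \<open>simp add: morita_D_simps(2)\<close>)
  have fH: "?f \<in> carrier (HM W)" using submoduleD(1)[OF D] fD by blast
  obtain n where n: "n \<in> carrier N" "?f n \<noteq> \<zero>\<^bsub>W\<^esub>" by (rule hom_module_nonzero[OF fH mw(3)])
  \<comment> \<open>The generator \<open>?f\<close> is used both as the map \<open>f\<close> and as
    the element to be expressed through it. Thus \<open>?f\<close> is a multiple of itself by an
    element of \<open>I\<close>, a nonzero product.\<close>
  obtain m' where m': "m' \<in> carrier M" "?f = pe m' n \<odot>\<^bsub>HM W\<^esub> ?f"
    by (rule DM_gen_eq_smult[OF W fH n mw(1,2)])
  have "pe m' n \<in> \<eta> ` carrier (bitensor M B N)"
    using m' n by (simp add: MN.pure_tensor_closed)
  moreover have "pe m' n \<odot>\<^bsub>DM W\<^esub> ?f \<noteq> \<zero>\<^bsub>DM W\<^esub>"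
    using m'(2) mw(3) unfolding morita_D_simps(2,4) by argo
  ultimately show "ideal_smult (\<eta> ` carrier (bitensor M B N)) (DM W) = carrier (DM W)"
    using ideal_smult_simple_iff[OF eta_image_ideal simple] fD by blast
qed

section \<open>The pairing criterion and its two applications\<close>

text \<open>Currying \<open>\<beta>\<close> gives an \<open>A\<close>-linear map \<open>h\<close>
  from \<open>V\<close> to \<open>HM W\<close>, nonzero at \<open>v0\<close>, hence injective. Its
  image is a nonzero submodule, so it contains \<open>DW\<close>; the reverse inclusion comes from
  simplicity of \<open>V\<close>.\<close>

lemma pairing_isomorphic:
  assumes W: "simple_left_module B W"
    and JW: "ideal_smult (\<rho> ` carrier (bitensor N A M)) W = carrier W"
    and V: "simple_left_module A V"
    and cl: "\<And>n v. \<lbrakk>n \<in> carrier N; v \<in> carrier V\<rbrakk> \<Longrightarrow> \<beta> n v \<in> carrier W"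
    and add_left: "\<And>n n' v. \<lbrakk>n \<in> carrier N; n' \<in> carrier N; v \<in> carrier V\<rbrakk> \<Longrightarrow>
      \<beta> (n \<oplus>\<^bsub>N\<^esub> n') v = \<beta> n v \<oplus>\<^bsub>W\<^esub> \<beta> n' v"
    and smult_left: "\<And>b n v. \<lbrakk>b \<in> carrier B; n \<in> carrier N; v \<in> carrier V\<rbrakk> \<Longrightarrow>
      \<beta> (b \<odot>\<^bsub>N\<^esub> n) v = b \<odot>\<^bsub>W\<^esub> \<beta> n v"
    and add_right: "\<And>n v v'. \<lbrakk>n \<in> carrier N; v \<in> carrier V; v' \<in> carrier V\<rbrakk> \<Longrightarrow>
      \<beta> n (v \<oplus>\<^bsub>V\<^esub> v') = \<beta> n v \<oplus>\<^bsub>W\<^esub> \<beta> n v'"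
    and balanced: "\<And>n a v. \<lbrakk>n \<in> carrier N; a \<in> carrier A; v \<in> carrier V\<rbrakk> \<Longrightarrow>
      \<beta> (n \<star>\<^bsub>N\<^esub> a) v = \<beta> n (a \<odot>\<^bsub>V\<^esub> v)"
    and nz: "n0 \<in> carrier N" "v0 \<in> carrier V" "\<beta> n0 v0 \<noteq> \<zero>\<^bsub>W\<^esub>"
  shows "left_module_isomorphic A V (DM W)"
proof -
  note W' = simple_left_moduleD(1)[OF W] and V' = simple_left_moduleD(1)[OF V]
  note H = hom_module_left_module[OF N.bimodule_axioms W']
  interpret V: left_module A V by (rule V')
  define h where "h v = (\<lambda>n\<in>carrier N. \<beta> n v)" for v
  have hh: "h \<in> left_module_hom A V (HM W)"
  proof (rule left_module_homI)
    show "h v \<in> carrier (HM W)" if "v \<in> carrier V" for v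
      unfolding h_def
      by (rule hom_module_closedI) (use that cl add_left smult_left N.left_module_axioms in auto)
    show "h (v \<oplus>\<^bsub>V\<^esub> w) = h v \<oplus>\<^bsub>HM W\<^esub> h w" if "v \<in> carrier V" "w \<in> carrier V" for v w
      using that by (auto simp: h_def hom_module_def fun_eq_iff add_right)
    show "h (a \<odot>\<^bsub>V\<^esub> v) = a \<odot>\<^bsub>HM W\<^esub> h v" if "a \<in> carrier A" "v \<in> carrier V" for a v
      using that by (auto simp: h_def hom_module_def fun_eq_iff balanced)
  qed
  have h0: "h v0 \<noteq> \<zero>\<^bsub>HM W\<^esub>"
    using nz by (auto simp: h_def hom_module_def dest!: fun_cong[of _ _ n0])
  have inj: "inj_on h (carrier V)"
    by (rule simple_left_module_hom_inj[OF V H hh nz(2) h0])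
  have sub: "carrier (DM W) \<subseteq> h ` carrier V"
    by (rule morita_D_subset_submodule[OF W submodule_image[OF V' H hh] _ h0]) (use nz in blast)
  obtain m w where mw: "m \<in> carrier M" "w \<in> carrier W" "DM_gen W m w \<noteq> \<zero>\<^bsub>HM W\<^esub>"
    by (rule DM_gen_nonzero[OF W JW])
  have fD: "DM_gen W m w \<in> carrier (DM W)" by (rule morita_D_gen[OF W' mw(1,2)])
  then obtain v where v: "v \<in> carrier V" "h v = DM_gen W m w"
    using sub by (metis (no_types, lifting) imageE subsetD)
  have "v \<noteq> \<zero>\<^bsub>V\<^esub>" using v mw(3) left_module_hom_zero[OF V' H hh] by metis
  \<comment> \<open>The preimage of \<open>DW\<close> is a submodule of \<open>V\<close> containing
    the nonzero \<open>v\<close>, so \<open>h\<close> maps all of \<open>V\<close> into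
    \<open>DW\<close>.\<close>
  then have "{v \<in> carrier V. h v \<in> carrier (DM W)} = carrier V"
    by (intro simple_left_moduleD(3)[OF V submodule_vimage[OF V' H hh morita_D_submodule[OF W']], of v])
      (use v fD in auto)
  then have "bij_betw h (carrier V) (carrier (DM W))"
    using sub inj by (auto simp: bij_betw_def)
  moreover have "h \<in> left_module_hom A V (DM W)"
    using \<open>{v \<in> carrier V. h v \<in> carrier (DM W)} = carrier V\<close>
    by (intro left_module_homI) (auto simp: left_module_homD[OF hh] morita_D_simps(3,4))
  ultimately show ?thesis by (auto simp: left_module_isomorphic_def)
qed

text \<open>Apply the criterion to the pairing of \<open>N\<close> and \<open>DW\<close> with values
  in \<open>W2\<close> that evaluates \<open>f\<close> at \<open>n\<close> and then applies the
  isomorphism \<open>g\<close>.\<close>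

lemma morita_D_isomorphic:
  assumes W: "simple_left_module B W"
    and JW: "ideal_smult (\<rho> ` carrier (bitensor N A M)) W = carrier W"
    and W2: "left_module B W2" and iso: "left_module_isomorphic B W W2"
  shows "left_module_isomorphic A (DM W) (DM W2)"
proof -
  note W' = simple_left_moduleD(1)[OF W]
  interpret W: left_module B W by (rule W')
  obtain g where g: "g \<in> left_module_hom B W W2" and b: "bij_betw g (carrier W) (carrier W2)"
    using iso by (auto simp: left_module_isomorphic_def)
  have DH: "f \<in> left_module_hom B N W" if "f \<in> carrier (DM W)" for f
    using that submoduleD(1)[OF morita_D_submodule[OF W']] hom_moduleD(1) by blast
  note f = left_module_homD[OF DH] and g' = left_module_homD[OF g]
  obtain m w where mw: "m \<in> carrier M" "w \<in> carrier W" "DM_gen W m w \<noteq> \<zero>\<^bsub>HM W\<^esub>"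
    by (rule DM_gen_nonzero[OF W JW])
  have fD: "DM_gen W m w \<in> carrier (DM W)" by (rule morita_D_gen[OF W' mw(1,2)])
  then have "DM_gen W m w \<in> carrier (HM W)"
    using submoduleD(1)[OF morita_D_submodule[OF W']] by blast
  then obtain n where n: "n \<in> carrier N" "DM_gen W m w n \<noteq> \<zero>\<^bsub>W\<^esub>"
    by (rule hom_module_nonzero[OF _ mw(3)])
  \<comment> \<open>Injectivity of \<open>g\<close> keeps the nonzero value nonzero.\<close>
  have nz: "g (DM_gen W m w n) \<noteq> \<zero>\<^bsub>W2\<^esub>"
    using b n f(1)[OF fD n(1)] left_module_hom_zero[OF W' W2 g]
    by (metis (no_types, lifting) W.zero_closed bij_betw_def inj_onD)
  show ?thesis
    by (rule pairing_isomorphic[OF simple_left_module_isomorphic[OF W W2 iso]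
          ideal_smult_isomorphic[OF rho_image_ideal W W2 iso JW] morita_D_simple(1)[OF W JW],
          where \<beta> = "\<lambda>n f. g (f n)" and ?n0.0 = n and ?v0.0 = "DM_gen W m w"])
      (use fD n nz in \<open>simp_all add: f g' morita_D_simps(3,4), simp_all add: hom_module_def f g'\<close>)
qed

text \<open>In the opposite context \<open>M\<close> plays the part of \<open>N\<close>, the simple
  \<open>A\<close>-module \<open>DW\<close> that of the target, and \<open>W\<close> that of
  \<open>V\<close>. The pairing is \<open>DM_gen W\<close> itself.\<close>

lemma morita_D_inverse:
  assumes W: "simple_left_module B W"
    and JW: "ideal_smult (\<rho> ` carrier (bitensor N A M)) W = carrier W"
  shows "left_module_isomorphic B W (morita_D B A N M \<eta> (DM W))"
proof -
  note W' = simple_left_moduleD(1)[OF W]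
  interpret b: balanced_map A B M W "HM W" "\<lambda>m w. DM_gen W m w" by (rule morita_balanced[OF W'])
  obtain m w where mw: "m \<in> carrier M" "w \<in> carrier W" "DM_gen W m w \<noteq> \<zero>\<^bsub>HM W\<^esub>"
    by (rule DM_gen_nonzero[OF W JW])
  \<comment> \<open>Linearity over \<open>A\<close> in \<open>m\<close> is the balancing of the
    tensor product of \<open>N\<close> and \<open>M\<close> over \<open>A\<close>:
    \<open>n \<otimes> a m = n a \<otimes> m\<close>.\<close>
  have sm: "DM_gen W (a \<odot>\<^bsub>M\<^esub> m) w = a \<odot>\<^bsub>HM W\<^esub> DM_gen W m w"
    if "a \<in> carrier A" "m \<in> carrier M" "w \<in> carrier W" for a m w
    using that by (auto simp: hom_module_def fun_eq_iff NM.pure_tensor_balanced)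
  show ?thesis
    by (rule morita_context.pairing_isomorphic[OF sym_context morita_D_simple[OF W JW] W,
          where \<beta> = "\<lambda>m w. DM_gen W m w" and ?n0.0 = m and ?v0.0 = w])
      (use mw in \<open>simp_all only: morita_D_gen[OF W'] morita_D_simps(2-4) b.phi_add_left b.phi_add_right
        b.phi_balanced sm not_False_eq_True\<close>)
qed

end

section \<open>The correspondence on isomorphism classes\<close>

theorem theorem0p3:
  fixes K :: "('k, 'r) ring_scheme"
    and A :: "('k, 'a, 's) module_scheme"
    and B :: "('k, 'b, 't) module_scheme"
    and M :: "('a, 'm, 'b, 'u) bimodule_scheme"
    and N :: "('b, 'n, 'a, 'v) bimodule_scheme"
    and \<eta> :: "('m \<times> 'n \<Rightarrow>\<^sub>0 int) set \<Rightarrow> 'a"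
    and \<rho> :: "('n \<times> 'm \<Rightarrow>\<^sub>0 int) set \<Rightarrow> 'b"
  assumes "cring K"
    and "assoc_algebra K A"
    and "assoc_algebra K B"
    and "morita_context A B M N \<eta> \<rho>"
    and I: "I = \<eta> ` carrier (bitensor M B N)"
    and J: "J = \<rho> ` carrier (bitensor N A M)"
  shows "\<exists>F. bij_betw F (Irr_ideal B J) (Irr_ideal A I) \<and>
    (\<forall>W :: ('b, 'b set) module. simple_left_module B W \<and> ideal_smult J W = carrier W \<longrightarrow>
      F (iso_class B W) = iso_class A (morita_D A B M N \<rho> W)) \<and>
    (\<forall>W :: ('b, 'w, 'x) module_scheme. simple_left_module B W \<and> ideal_smult J W = carrier W \<longrightarrow>
      simple_left_module A (morita_D A B M N \<rho> W) \<and>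
      ideal_smult I (morita_D A B M N \<rho> W) = carrier (morita_D A B M N \<rho> W) \<and>
      F (iso_class B W) = iso_class A (morita_D A B M N \<rho> W))"
proof -
  interpret morita_context A B M N \<eta> \<rho> by (rule assms(4))
  let ?D = "\<lambda>W. morita_D A B M N \<rho> W" and ?E = "\<lambda>V. morita_D B A N M \<eta> V"
  have Ii: "ideal I A" and Ji: "ideal J B"
    unfolding I J by (rule eta_image_ideal rho_image_ideal)+
  note D = morita_D_simple[folded I J] and Diso = morita_D_isomorphic[folded I J]
    and ED = morita_D_inverse[folded I J]
  \<comment> \<open>The same three facts for the opposite context, so that \<open>?E\<close> runs
    from \<open>A\<close>-modules to \<open>B\<close>-modules.\<close>
  note E = morita_context.morita_D_simple[OF sym_context, folded I J]
    and Eiso = morita_context.morita_D_isomorphic[OF sym_context, folded I J]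
    and DE = morita_context.morita_D_inverse[OF sym_context, folded I J]
  \<comment> \<open>\<open>F\<close> acts through a chosen member of the class; the next fact shows
    independence of the choice, for \<open>W\<close> on any type.\<close>
  define F where "F c = iso_class A (?D (SOME W. W \<in> c))" for c :: "('b, 'b set) module set"
  have F: "F (iso_class B W) = iso_class A (?D W)"
    if W: "simple_left_module B W" "ideal_smult J W = carrier W" for W :: "('b, 'z, 'y) module_scheme"
  proof -
    let ?W = "SOME W'. W' \<in> iso_class B W"
    have "?W \<in> iso_class B W" using iso_class_nonempty[OF W(1)] by (simp add: some_in_eq)
    note s = iso_class_simple[OF Ji W this]
    have "left_module_isomorphic A (?D W) (?D ?W)"
      by (rule Diso[OF W simple_left_moduleD(1)[OF s(1)] s(3)])
    then show ?thesis
      using iso_class_eq_iff[OF D(1)[OF W] D(1)[OF s(1,2)]] by (simp add: F_def)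
  qed
  have "bij_betw F (Irr_ideal B J) (Irr_ideal A I)"
  proof (rule bij_betw_imageI)
    show "inj_on F (Irr_ideal B J)"
    proof (rule inj_onI)
      fix c c' assume "c \<in> Irr_ideal B J" "c' \<in> Irr_ideal B J" and eq: "F c = F c'"
      then obtain W W' :: "('b, 'b set) module"
        where W: "simple_left_module B W" "ideal_smult J W = carrier W" "c = iso_class B W"
          and W': "simple_left_module B W'" "ideal_smult J W' = carrier W'" "c' = iso_class B W'"
        by (auto simp: Irr_ideal_def)
      note DW = D[OF W(1,2)] and DW' = D[OF W'(1,2)]
      have "left_module_isomorphic A (?D W) (?D W')"
        using eq iso_class_eq_iff[OF DW(1) DW'(1)] F[OF W(1,2)] F[OF W'(1,2)] W(3) W'(3) by simp
      \<comment> \<open>Injectivity follows along the chain from \<open>W\<close> through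
        \<open>E(DW)\<close> and \<open>E(DW')\<close> to \<open>W'\<close>.\<close>
      then have "left_module_isomorphic B (?E (?D W)) (?E (?D W'))"
        by (rule Eiso[OF DW simple_left_moduleD(1)[OF DW'(1)]])
      then have "left_module_isomorphic B W (?E (?D W'))"
        by (rule left_module_isomorphic_trans[OF ED[OF W(1,2)]])
      then have "left_module_isomorphic B W W'"
        by (rule left_module_isomorphic_trans)
          (rule left_module_isomorphic_sym[OF simple_left_moduleD(1)[OF W'(1)] ED[OF W'(1,2)]])
      then show "c = c'" using iso_class_eq_iff[OF W(1) W'(1)] W(3) W'(3) by simp
    qed
    show "F ` Irr_ideal B J = Irr_ideal A I"
    proof (intro equalityI subsetI)
      fix c assume "c \<in> F ` Irr_ideal B J"
      then obtain W :: "('b, 'b set) module"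
        where W: "simple_left_module B W" "ideal_smult J W = carrier W" "c = F (iso_class B W)"
        by (auto simp: Irr_ideal_def)
      then show "c \<in> Irr_ideal A I"
        using F[OF W(1,2)] iso_class_in_Irr_ideal[OF Ii D[OF W(1,2)]] by simp
    next
      fix c assume "c \<in> Irr_ideal A I"
      then obtain V :: "('a, 'a set) module"
        where V: "simple_left_module A V" "ideal_smult I V = carrier V" "c = iso_class A V"
        by (auto simp: Irr_ideal_def)
      note EV = E[OF V(1,2)]
      \<comment> \<open>The preimage is the class of \<open>EV\<close>, since \<open>V\<close> is
        isomorphic to \<open>D(EV)\<close>. The elements of \<open>EV\<close> are maps on
        \<open>M\<close>, so the version of \<open>F\<close> for arbitrary types is used.\<close>
      have "c = F (iso_class B (?E V))"
        using iso_class_eq_iff[OF V(1) D(1)[OF EV]] DE[OF V(1,2)] F[OF EV] V(3) by simp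
      then show "c \<in> F ` Irr_ideal B J"
        using iso_class_in_Irr_ideal[OF Ji EV] by blast
    qed
  qed
  then show ?thesis
    by (intro exI[of _ F] conjI allI impI) (simp_all add: F D)
qed

end
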